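(* Let $W$ be a Weyl group, $\mathbf I=\{w\in W; w^2=1\}$, and let $\underline M$ be the free $\mathbb Z[v,v^{-1}]$-module with basis $(a_w)_{w\in\mathbf I}$ equipped with the bar involution $\bar{\ }:\underline M\to\underline M$ described in the context. Put $u=v^2$. (a) For any $w\in\mathbf I$ there is a unique element $$A_w=v^{-l(w)}\sum_{y\in\mathbf I;\,y\le w}P^\sigma_{y,w}a_y\in\underline M\qquad (P^\sigma_{y,w}\in\mathbb Z[u])$$ such that $\overline{A_w}=A_w$, $P^\sigma_{w,w}=1$, and for any $y\in\mathbf I$ with $y<w$ we have $\deg P^\sigma_{y,w}\le (l(w)-l(y)-1)/2$ (degree as a polynomial in $u$). (b) The elements $A_w$ ($w\in\mathbf I$) form a $\mathbb Z[v,v^{-1}]$-basis of $\underline M$.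
   Context: $W$ is a (finite) Weyl group with standard generating set $S$, length function $l$ and Bruhat order $\le$. Let $\mathcal A=\mathbb Z[u,u^{-1}]$, $u$ an indeterminate, and let $M$ be the free $\mathcal A$-module with basis $(a_w)_{w\in\mathbf I}$. For $s\in S$ define an $\mathcal A$-linear map $T_s:M\to M$ by: $(T_s+1)(a_w)=(u+1)(a_w+a_{sw})$ if $sw=ws>w$; $(T_s+1)(a_w)=(u^2-u)(a_w+a_{sw})$ if $sw=ws<w$; $(T_s+1)(a_w)=a_w+a_{sws}$ if $sw\ne ws$ and $ws>w$; $(T_s+1)(a_w)=u^2(a_w+a_{sws})$ if $sw\ne ws$ and $ws<w$. There is a unique $\mathbb Z$-linear map $\bar{\ }:M\to M$ such that $\overline{u^nm}=u^{-n}\overline m$ for all $m\in M,n\in\mathbb Z$, $\overline{a_1}=a_1$, and $\overline{(T_s+1)m}=u^{-2}(T_s+1)\overline m$ for all $m\in M,s\in S$. Let $\underline{\mathcal A}=\mathbb Z[v,v^{-1}]$, $v$ an indeterminate, regarded as containing $\mathcal A$ via $u=v^2$, and let $\underline M=\underline{\mathcal A}\otimes_{\mathcal A}M\supset M$. The map $\bar{\ }$ is extended to a $\mathbb Z$-linear map $\bar{\ }:\underline M\to\underline M$ such that $\overline{v^nm}=v^{-n}\overline m$ for $m\in\underline M$, $n\in\mathbb Z$. *)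

theory Defs
  imports
    "HOL-Analysis.Analysis"
    "HOL-Library.Poly_Mapping"
    "HOL-Computational_Algebra.Polynomial"
begin

section \<open>Weyl groups\<close>

definition root_reflection :: "'a::euclidean_space \<Rightarrow> 'a \<Rightarrow> 'a" where
  "root_reflection \<alpha> x = x - (2 * (x \<bullet> \<alpha>) / (\<alpha> \<bullet> \<alpha>)) *\<^sub>R \<alpha>"

text \<open>Reduced crystallographic root systems. The roots are not required to span the ambient space
  (\<open>\<Phi>\<close> is a root system in its own span), so that the trivial Weyl group is included although
  Euclidean spaces here have positive dimension.\<close>

definition root_system :: "'a::euclidean_space set \<Rightarrow> bool" where
  "root_system \<Phi> \<longleftrightarrow>
     finite \<Phi> \<and> 0 \<notin> \<Phi> \<and>
     (\<forall>\<alpha>\<in>\<Phi>. root_reflection \<alpha> ` \<Phi> = \<Phi>) \<and>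
     (\<forall>\<alpha>\<in>\<Phi>. \<forall>c. c *\<^sub>R \<alpha> \<in> \<Phi> \<longrightarrow> c = 1 \<or> c = - 1) \<and>
     (\<forall>\<alpha>\<in>\<Phi>. \<forall>\<beta>\<in>\<Phi>. 2 * (\<beta> \<bullet> \<alpha>) / (\<alpha> \<bullet> \<alpha>) \<in> \<int>)"

definition root_base :: "'a::euclidean_space set \<Rightarrow> 'a set \<Rightarrow> bool" where
  "root_base \<Phi> \<Delta> \<longleftrightarrow>
     \<Delta> \<subseteq> \<Phi> \<and> independent \<Delta> \<and>
     (\<forall>\<beta>\<in>\<Phi>. \<exists>c::'a \<Rightarrow> nat.
        \<beta> = (\<Sum>\<alpha>\<in>\<Delta>. real (c \<alpha>) *\<^sub>R \<alpha>) \<or> \<beta> = - (\<Sum>\<alpha>\<in>\<Delta>. real (c \<alpha>) *\<^sub>R \<alpha>))"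

text \<open>The group law is composition of maps. Reflections are involutions, so closure under
  multiplication by the generators already gives the generated subgroup.\<close>

inductive_set weyl_group :: "'a::euclidean_space set \<Rightarrow> ('a \<Rightarrow> 'a) set" for \<Phi> where
  one: "id \<in> weyl_group \<Phi>"
| mult: "\<alpha> \<in> \<Phi> \<Longrightarrow> w \<in> weyl_group \<Phi> \<Longrightarrow> root_reflection \<alpha> \<circ> w \<in> weyl_group \<Phi>"

definition simple_reflections :: "'a::euclidean_space set \<Rightarrow> ('a \<Rightarrow> 'a) set" where
  "simple_reflections \<Delta> = root_reflection ` \<Delta>"

definition word_length :: "('a \<Rightarrow> 'a) set \<Rightarrow> ('a \<Rightarrow> 'a) \<Rightarrow> nat" where
  "word_length S w = (LEAST k. \<exists>ss. length ss = k \<and> set ss \<subseteq> S \<and> w = foldr (\<circ>) ss id)"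

definition group_reflections :: "('a \<Rightarrow> 'a) set \<Rightarrow> ('a \<Rightarrow> 'a) set \<Rightarrow> ('a \<Rightarrow> 'a) set" where
  "group_reflections W S = {x \<circ> s \<circ> inv x | x s. x \<in> W \<and> s \<in> S}"

definition bruhat_le :: "('a \<Rightarrow> 'a) set \<Rightarrow> ('a \<Rightarrow> 'a) set \<Rightarrow> ('a \<Rightarrow> 'a) \<Rightarrow> ('a \<Rightarrow> 'a) \<Rightarrow> bool" where
  "bruhat_le W S =
     (\<lambda>y w. \<exists>t\<in>group_reflections W S. w = t \<circ> y \<and> word_length S y < word_length S w)\<^sup>*\<^sup>*"

definition bruhat_less :: "('a \<Rightarrow> 'a) set \<Rightarrow> ('a \<Rightarrow> 'a) set \<Rightarrow> ('a \<Rightarrow> 'a) \<Rightarrow> ('a \<Rightarrow> 'a) \<Rightarrow> bool" where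
  "bruhat_less W S y w \<longleftrightarrow> bruhat_le W S y w \<and> y \<noteq> w"

definition involutions :: "('a \<Rightarrow> 'a) set \<Rightarrow> ('a \<Rightarrow> 'a) set" where
  "involutions W = {w \<in> W. w \<circ> w = id}"


section \<open>Laurent polynomials and free modules over them\<close>

text \<open>\<open>\<int>[v,v\<^sup>-\<^sup>1]\<close> is the group ring of \<open>\<int>\<close>: finitely supported functions on the exponents of \<open>v\<close>,
  with convolution as multiplication. The subring \<open>\<int>[u,u\<^sup>-\<^sup>1]\<close>, \<open>u = v\<^sup>2\<close>, consists of the Laurent
  polynomials in which only even powers of \<open>v\<close> occur.\<close>

type_synonym laurent = "int \<Rightarrow>\<^sub>0 int"

definition vpow :: "int \<Rightarrow> laurent" where
  "vpow n = Poly_Mapping.single n 1"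

definition upow :: "int \<Rightarrow> laurent" where
  "upow n = vpow (2 * n)"

definition laurent_u :: "laurent set" where
  "laurent_u = {p. \<forall>n\<in>Poly_Mapping.keys p. even n}"

text \<open>The inclusion \<open>\<int>[u] \<subseteq> \<int>[v,v\<^sup>-\<^sup>1]\<close>.\<close>

definition u_poly :: "int poly \<Rightarrow> laurent" where
  "u_poly p = poly (map_poly of_int p) (upow 1)"

definition lscale :: "laurent \<Rightarrow> ('w \<Rightarrow>\<^sub>0 laurent) \<Rightarrow> ('w \<Rightarrow>\<^sub>0 laurent)" (infixr \<open>*\<^sub>L\<close> 75) where
  "c *\<^sub>L m = Poly_Mapping.map (\<lambda>a. c * a) m"

lemma lookup_lscale [simp]: "Poly_Mapping.lookup (c *\<^sub>L m) w = c * Poly_Mapping.lookup m w"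
  by (simp add: lscale_def Poly_Mapping.map.rep_eq when_def)

global_interpretation lmod: module "(*\<^sub>L) :: laurent \<Rightarrow> ('w \<Rightarrow>\<^sub>0 laurent) \<Rightarrow> ('w \<Rightarrow>\<^sub>0 laurent)"
  by standard (auto intro!: poly_mapping_eqI simp: lookup_add algebra_simps)

definition basis_elt :: "'w \<Rightarrow> ('w \<Rightarrow>\<^sub>0 laurent)" where
  "basis_elt w = Poly_Mapping.single w 1"

text \<open>The free \<open>\<int>[v,v\<^sup>-\<^sup>1]\<close>-module on the index set \<open>I\<close>, and inside it the free
  \<open>\<int>[u,u\<^sup>-\<^sup>1]\<close>-module on \<open>I\<close>.\<close>

definition free_module_v :: "'w set \<Rightarrow> ('w \<Rightarrow>\<^sub>0 laurent) set" where
  "free_module_v I = {m. Poly_Mapping.keys m \<subseteq> I}"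

definition free_module_u :: "'w set \<Rightarrow> ('w \<Rightarrow>\<^sub>0 laurent) set" where
  "free_module_u I = {m \<in> free_module_v I. \<forall>w. Poly_Mapping.lookup m w \<in> laurent_u}"

definition is_basis_family :: "'w set \<Rightarrow> ('w \<Rightarrow> ('i \<Rightarrow>\<^sub>0 laurent)) \<Rightarrow> ('i \<Rightarrow>\<^sub>0 laurent) set \<Rightarrow> bool" where
  "is_basis_family I f N \<longleftrightarrow>
     inj_on f I \<and> lmod.independent (f ` I) \<and> lmod.span (f ` I) = N"


section \<open>The Hecke operators and the bar involution\<close>

text \<open>\<open>T_plus_one_basis W S s w\<close> is \<open>(T\<^sub>s + 1) a\<^sub>w\<close>. The \<open>else\<close> branches are the cases
  \<open>sw < w\<close> and \<open>ws < w\<close>: two elements of \<open>W\<close> that differ by a reflection are Bruhat comparable.\<close>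

definition T_plus_one_basis ::
    "('a \<Rightarrow> 'a) set \<Rightarrow> ('a \<Rightarrow> 'a) set \<Rightarrow> ('a \<Rightarrow> 'a) \<Rightarrow> ('a \<Rightarrow> 'a) \<Rightarrow> (('a \<Rightarrow> 'a) \<Rightarrow>\<^sub>0 laurent)" where
  "T_plus_one_basis W S s w =
     (if s \<circ> w = w \<circ> s then
        (if bruhat_less W S w (s \<circ> w)
         then (upow 1 + 1) *\<^sub>L (basis_elt w + basis_elt (s \<circ> w))
         else (upow 2 - upow 1) *\<^sub>L (basis_elt w + basis_elt (s \<circ> w)))
      else
        (if bruhat_less W S w (w \<circ> s)
         then basis_elt w + basis_elt (s \<circ> w \<circ> s)
         else upow 2 *\<^sub>L (basis_elt w + basis_elt (s \<circ> w \<circ> s))))"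

definition hecke_T ::
    "('a \<Rightarrow> 'a) set \<Rightarrow> ('a \<Rightarrow> 'a) set \<Rightarrow> ('a \<Rightarrow> 'a) \<Rightarrow>
     (('a \<Rightarrow> 'a) \<Rightarrow>\<^sub>0 laurent) \<Rightarrow> (('a \<Rightarrow> 'a) \<Rightarrow>\<^sub>0 laurent)" where
  "hecke_T W S s m =
     (\<Sum>w\<in>Poly_Mapping.keys m.
        Poly_Mapping.lookup m w *\<^sub>L (T_plus_one_basis W S s w - basis_elt w))"

text \<open>The characterizing properties of the bar map on the \<open>\<int>[u,u\<^sup>-\<^sup>1]\<close>-module \<open>M\<close>.\<close>

definition is_bar_u ::
    "('a \<Rightarrow> 'a) set \<Rightarrow> ('a \<Rightarrow> 'a) set \<Rightarrow>
     ((('a \<Rightarrow> 'a) \<Rightarrow>\<^sub>0 laurent) \<Rightarrow> (('a \<Rightarrow> 'a) \<Rightarrow>\<^sub>0 laurent)) \<Rightarrow> bool" where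
  "is_bar_u W S bar \<longleftrightarrow>
     (let M = free_module_u (involutions W) in
        (\<forall>m\<in>M. bar m \<in> M) \<and>
        (\<forall>m\<in>M. \<forall>m'\<in>M. bar (m + m') = bar m + bar m') \<and>
        (\<forall>m\<in>M. \<forall>n. bar (upow n *\<^sub>L m) = upow (- n) *\<^sub>L bar m) \<and>
        bar (basis_elt id) = basis_elt id \<and>
        (\<forall>m\<in>M. \<forall>s\<in>S. bar (hecke_T W S s m + m) = upow (- 2) *\<^sub>L (hecke_T W S s (bar m) + bar m)))"

text \<open>The semilinear extension of the bar map to the \<open>\<int>[v,v\<^sup>-\<^sup>1]\<close>-module. Only the values of \<open>bar\<close> on this
  module are constrained.\<close>

definition is_bar ::
    "('a \<Rightarrow> 'a) set \<Rightarrow> ('a \<Rightarrow> 'a) set \<Rightarrow>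
     ((('a \<Rightarrow> 'a) \<Rightarrow>\<^sub>0 laurent) \<Rightarrow> (('a \<Rightarrow> 'a) \<Rightarrow>\<^sub>0 laurent)) \<Rightarrow> bool" where
  "is_bar W S bar \<longleftrightarrow>
     is_bar_u W S bar \<and>
     (let M = free_module_v (involutions W) in
        (\<forall>m\<in>M. bar m \<in> M) \<and>
        (\<forall>m\<in>M. \<forall>m'\<in>M. bar (m + m') = bar m + bar m') \<and>
        (\<forall>m\<in>M. \<forall>n. bar (vpow n *\<^sub>L m) = vpow (- n) *\<^sub>L bar m))"


section \<open>The canonical elements\<close>

text \<open>\<open>P y\<close> is the polynomial \<open>P\<^sup>\<sigma>\<^sub>y\<^sub>,\<^sub>w \<in> \<int>[u]\<close>. For \<open>y < w\<close> the degree bound is nonnegative, so the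
  convention that the zero polynomial has degree 0 is harmless.\<close>

definition is_canonical_elt ::
    "('a \<Rightarrow> 'a) set \<Rightarrow> ('a \<Rightarrow> 'a) set \<Rightarrow>
     ((('a \<Rightarrow> 'a) \<Rightarrow>\<^sub>0 laurent) \<Rightarrow> (('a \<Rightarrow> 'a) \<Rightarrow>\<^sub>0 laurent)) \<Rightarrow>
     ('a \<Rightarrow> 'a) \<Rightarrow> (('a \<Rightarrow> 'a) \<Rightarrow>\<^sub>0 laurent) \<Rightarrow> bool" where
  "is_canonical_elt W S bar w A \<longleftrightarrow>
     (\<exists>P :: ('a \<Rightarrow> 'a) \<Rightarrow> int poly.
        A = vpow (- int (word_length S w)) *\<^sub>L
              (\<Sum>y\<in>{y \<in> involutions W. bruhat_le W S y w}. u_poly (P y) *\<^sub>L basis_elt y) \<and>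
        bar A = A \<and>
        P w = 1 \<and>
        (\<forall>y\<in>involutions W. bruhat_less W S y w \<longrightarrow>
           real (Polynomial.degree (P y))
             \<le> (real (word_length S w) - real (word_length S y) - 1) / 2))"

end

theory Submission
  imports Defs
begin

text \<open>The bar map is triangular: by induction along the moves \<open>w \<mapsto> s w\<close> (if \<open>s\<close> and \<open>w\<close> commute) and
  \<open>w \<mapsto> s w s\<close> (otherwise), the element \<open>bar a\<^sub>w\<close> is supported on \<open>y \<le> w\<close>, its coefficient at \<open>w\<close> is
  \<open>u\<^sup>-\<^sup>l\<^sup>(\<^sup>w\<^sup>)\<close>, and all its coefficients lie in \<open>u\<^sup>-\<^sup>l\<^sup>(\<^sup>w\<^sup>) \<int>[u]\<close>; the lifting property of the Bruhat order
  controls the support, and the factor \<open>u + 1\<close> of the commuting case can be cancelled without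
  lowering exponents because its constant term is \<open>1\<close>. The same induction shows that bar is an involution. The
  Kazhdan--Lusztig argument then applies: \<open>bar a - a\<close>, for \<open>a = v\<^sup>-\<^sup>l\<^sup>(\<^sup>w\<^sup>) a\<^sub>w\<close>, is anti-invariant, and
  splitting off negative parts of coefficients writes it uniquely as \<open>E - bar E\<close>, so that \<open>a + E\<close> is
  invariant. The bound on exponents from below survives the splitting, which is why the coefficients
  are polynomials in \<open>u\<close> and not just Laurent polynomials.\<close>

section \<open>Exchange condition and Bruhat order for Weyl groups\<close>

lemma root_reflection_linear: "linear (root_reflection \<alpha>)"
  by (rule linearI) (auto simp: root_reflection_def inner_add_left algebra_simps add_divide_distrib)

lemma root_reflection_minus [simp]: "root_reflection (- \<alpha>) = root_reflection \<alpha>"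
  by (auto simp: root_reflection_def)

lemma root_reflection_self: "\<alpha> \<noteq> 0 \<Longrightarrow> root_reflection \<alpha> \<alpha> = - \<alpha>"
  by (simp add: root_reflection_def algebra_simps scaleR_2)

lemma root_reflection_involution: "\<alpha> \<noteq> 0 \<Longrightarrow> root_reflection \<alpha> \<circ> root_reflection \<alpha> = id"
  by (rule ext) (simp add: root_reflection_def inner_diff_left)

lemma orthogonal_root_reflection:
  assumes "\<alpha> \<noteq> 0" shows "orthogonal_transformation (root_reflection \<alpha>)"
proof -
  have "root_reflection \<alpha> x \<bullet> root_reflection \<alpha> y = x \<bullet> y" for x y
    using assms by (simp add: root_reflection_def inner_diff_left inner_diff_right inner_commute field_simps)
  then show ?thesis
    by (simp add: orthogonal_transformation_def root_reflection_linear)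
qed

text \<open>An isometry preserves the inner products in the reflection formula, so it carries the
  hyperplane of one root to that of the other. Stating this as a commutation rule avoids
  inverses.\<close>

lemma orthogonal_comp_root_reflection:
  assumes "orthogonal_transformation w"
  shows "w \<circ> root_reflection \<alpha> = root_reflection (w \<alpha>) \<circ> w"
proof
  fix x
  have "linear w" and "\<And>x y. w x \<bullet> w y = x \<bullet> y"
    using assms by (auto simp: orthogonal_transformation_def)
  then show "(w \<circ> root_reflection \<alpha>) x = (root_reflection (w \<alpha>) \<circ> w) x"
    by (simp add: root_reflection_def linear_diff linear_scale)
qed

section \<open>Words in the generators\<close>

definition wd :: "('a \<Rightarrow> 'a) list \<Rightarrow> 'a \<Rightarrow> 'a" where
  "wd ss = foldr (\<circ>) ss id"

lemma wd_Nil [simp]: "wd [] = id"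
  and wd_Cons [simp]: "wd (s # ss) = s \<circ> wd ss"
  by (simp_all add: wd_def)

lemma wd_append [simp]: "wd (ss @ ts) = wd ss \<circ> wd ts"
  by (induction ss) (simp_all add: comp_assoc)

lemma word_length_le: "set ss \<subseteq> S \<Longrightarrow> word_length S (wd ss) \<le> length ss"
  unfolding word_length_def wd_def by (rule Least_le) auto

text \<open>The minimum defining \<open>word_length\<close> is attained as soon as some word
  represents \<open>w\<close>. For Weyl groups this is supplied later by
  \<open>weyl_word\<close>.\<close>

lemma word_length_witness:
  assumes "set ss \<subseteq> S" "w = wd ss"
  obtains ts where "set ts \<subseteq> S" "length ts = word_length S w" "w = wd ts"
proof -
  have "\<exists>ts. length ts = word_length S w \<and> set ts \<subseteq> S \<and> w = wd ts"
    unfolding word_length_def wd_def by (rule LeastI[of _ "length ss"], intro exI[of _ ss])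
      (simp only: assms(1) assms(2)[unfolded wd_def])
  then show ?thesis using that by auto
qed

section \<open>Positive roots of a based root system\<close>

locale based_root_system =
  fixes \<Phi> \<Delta> :: "'a::euclidean_space set"
  assumes root_system: "root_system \<Phi>" and root_base: "root_base \<Phi> \<Delta>"
begin

abbreviation W where "W \<equiv> weyl_group \<Phi>"
abbreviation S where "S \<equiv> simple_reflections \<Delta>"
abbreviation len where "len \<equiv> word_length S"
abbreviation le where "le \<equiv> bruhat_le W S"
abbreviation coord where "coord \<beta> \<equiv> representation \<Delta> \<beta>"

text \<open>Positivity is read off the coordinates in the base, which are linear in the root.
  \<open>coord_sum\<close> connects them with the natural coefficients in
  \<open>root_base\<close>.\<close>

definition pos :: "'a \<Rightarrow> bool" where
  "pos \<beta> \<longleftrightarrow> \<beta> \<in> \<Phi> \<and> (\<forall>\<gamma>\<in>\<Delta>. 0 \<le> coord \<beta> \<gamma>)"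

lemma finite_roots: "finite \<Phi>" and root_nonzero: "\<alpha> \<in> \<Phi> \<Longrightarrow> \<alpha> \<noteq> 0"
  and reflection_roots: "\<alpha> \<in> \<Phi> \<Longrightarrow> root_reflection \<alpha> ` \<Phi> = \<Phi>"
  and roots_reduced: "\<alpha> \<in> \<Phi> \<Longrightarrow> c *\<^sub>R \<alpha> \<in> \<Phi> \<Longrightarrow> c = 1 \<or> c = - 1"
  using root_system by (auto simp: root_system_def)

lemma base_roots: "\<Delta> \<subseteq> \<Phi>" and base_independent: "independent \<Delta>"
  using root_base by (auto simp: root_base_def)

lemma finite_base: "finite \<Delta>"
  using finite_roots base_roots finite_subset by blast

lemma reflection_root: "\<alpha> \<in> \<Phi> \<Longrightarrow> \<beta> \<in> \<Phi> \<Longrightarrow> root_reflection \<alpha> \<beta> \<in> \<Phi>"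
  using reflection_roots by blast

lemma minus_root: "\<alpha> \<in> \<Phi> \<Longrightarrow> - \<alpha> \<in> \<Phi>"
  using reflection_root[of \<alpha> \<alpha>] root_nonzero by (simp add: root_reflection_self)

lemma root_span: "\<beta> \<in> \<Phi> \<Longrightarrow> \<beta> \<in> span \<Delta>"
proof -
  assume "\<beta> \<in> \<Phi>"
  then obtain c :: "'a \<Rightarrow> nat" where "\<beta> = (\<Sum>\<alpha>\<in>\<Delta>. real (c \<alpha>) *\<^sub>R \<alpha>) \<or> \<beta> = - (\<Sum>\<alpha>\<in>\<Delta>. real (c \<alpha>) *\<^sub>R \<alpha>)"
    using root_base unfolding root_base_def by metis
  moreover have "(\<Sum>\<alpha>\<in>\<Delta>. real (c \<alpha>) *\<^sub>R \<alpha>) \<in> span \<Delta>"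
    by (intro span_sum span_scale span_base)
  ultimately show ?thesis using span_neg by auto
qed

lemma coord_sum:
  assumes "\<gamma> \<in> \<Delta>"
  shows "coord (\<Sum>\<alpha>\<in>\<Delta>. c \<alpha> *\<^sub>R \<alpha>) \<gamma> = c \<gamma>"
proof -
  have "coord (\<Sum>\<alpha>\<in>\<Delta>. c \<alpha> *\<^sub>R \<alpha>) \<gamma> = (\<Sum>\<alpha>\<in>\<Delta>. coord (c \<alpha> *\<^sub>R \<alpha>) \<gamma>)"
    by (subst representation_sum)
      (auto simp: base_independent span_base span_scale)
  also have "\<dots> = (\<Sum>\<alpha>\<in>\<Delta>. if \<alpha> = \<gamma> then c \<alpha> else 0)"
    by (rule sum.cong)
      (auto simp: representation_scale representation_basis base_independent span_base)
  also have "\<dots> = c \<gamma>" using assms finite_base by simp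
  finally show ?thesis .
qed

lemma sum_coord: "\<beta> \<in> \<Phi> \<Longrightarrow> (\<Sum>\<gamma>\<in>\<Delta>. coord \<beta> \<gamma> *\<^sub>R \<gamma>) = \<beta>"
  by (rule sum_representation_eq) (auto simp: base_independent root_span finite_base)

lemma coord_minus: "\<beta> \<in> \<Phi> \<Longrightarrow> coord (- \<beta>) \<gamma> = - coord \<beta> \<gamma>"
  by (simp add: representation_neg base_independent root_span)

lemma coord_reflection:
  assumes "\<alpha> \<in> \<Delta>" "\<beta> \<in> \<Phi>"
  shows "coord (root_reflection \<alpha> \<beta>) \<gamma>
    = coord \<beta> \<gamma> - (if \<gamma> = \<alpha> then 2 * (\<beta> \<bullet> \<alpha>) / (\<alpha> \<bullet> \<alpha>) else 0)"
  using assms unfolding root_reflection_def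
  by (simp add: representation_diff representation_scale representation_basis
      base_independent root_span span_base span_scale)

lemma pos_root: "pos \<beta> \<Longrightarrow> \<beta> \<in> \<Phi>"
  by (simp add: pos_def)

lemma pos_or_neg: "\<beta> \<in> \<Phi> \<Longrightarrow> pos \<beta> \<or> pos (- \<beta>)"
proof -
  assume b: "\<beta> \<in> \<Phi>"
  then obtain c :: "'a \<Rightarrow> nat" where "\<beta> = (\<Sum>\<alpha>\<in>\<Delta>. real (c \<alpha>) *\<^sub>R \<alpha>) \<or> \<beta> = - (\<Sum>\<alpha>\<in>\<Delta>. real (c \<alpha>) *\<^sub>R \<alpha>)"
    using root_base unfolding root_base_def by metis
  then show ?thesis
    using b minus_root[OF b] by (auto simp: pos_def coord_sum)
qed

lemma not_pos_and_neg: "pos \<beta> \<Longrightarrow> \<not> pos (- \<beta>)"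
proof
  assume a: "pos \<beta>" "pos (- \<beta>)"
  have "coord \<beta> \<gamma> = 0" if "\<gamma> \<in> \<Delta>" for \<gamma>
    using a that by (force simp: pos_def coord_minus)
  then have "(\<Sum>\<gamma>\<in>\<Delta>. coord \<beta> \<gamma> *\<^sub>R \<gamma>) = 0" by simp
  then show False using sum_coord root_nonzero a pos_root by metis
qed

lemma pos_base: "\<alpha> \<in> \<Delta> \<Longrightarrow> pos \<alpha>"
  using base_roots by (auto simp: pos_def representation_basis base_independent)

text \<open>The reflection changes only the coordinate at \<alpha>. If the image were negative, all
  other coordinates of \<beta> would be both nonnegative and nonpositive, so \<beta> would be a
  multiple of \<alpha>; reducedness and positivity then leave only \<alpha> itself.\<close>

lemma simple_reflection_pos:
  assumes a: "\<alpha> \<in> \<Delta>" and b: "pos \<beta>" and ne: "\<beta> \<noteq> \<alpha>"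
  shows "pos (root_reflection \<alpha> \<beta>)"
proof (rule ccontr)
  assume "\<not> pos (root_reflection \<alpha> \<beta>)"
  moreover have r: "root_reflection \<alpha> \<beta> \<in> \<Phi>"
    using a b base_roots pos_root reflection_root by blast
  ultimately have n: "pos (- root_reflection \<alpha> \<beta>)" using pos_or_neg by blast
  have z: "coord \<beta> \<gamma> = 0" if g: "\<gamma> \<in> \<Delta>" "\<gamma> \<noteq> \<alpha>" for \<gamma>
  proof -
    have "coord \<beta> \<gamma> \<ge> 0" using b g by (simp add: pos_def)
    moreover have "coord (- root_reflection \<alpha> \<beta>) \<gamma> \<ge> 0" using n g by (simp add: pos_def)
    then have "- coord \<beta> \<gamma> \<ge> 0"
      using g coord_minus[OF r] coord_reflection[OF a pos_root[OF b], of \<gamma>] by simp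
    ultimately show ?thesis by simp
  qed
  have "\<beta> = (\<Sum>\<gamma>\<in>\<Delta>. coord \<beta> \<gamma> *\<^sub>R \<gamma>)" using sum_coord pos_root[OF b] by simp
  also have "\<dots> = (\<Sum>\<gamma>\<in>\<Delta>. if \<gamma> = \<alpha> then coord \<beta> \<alpha> *\<^sub>R \<alpha> else 0)"
    by (rule sum.cong) (auto simp: z)
  also have "\<dots> = coord \<beta> \<alpha> *\<^sub>R \<alpha>" using a finite_base by simp
  finally have e: "\<beta> = coord \<beta> \<alpha> *\<^sub>R \<alpha>" .
  then have "coord \<beta> \<alpha> = 1 \<or> coord \<beta> \<alpha> = - 1"
    using roots_reduced[of \<alpha> "coord \<beta> \<alpha>"] a base_roots pos_root[OF b] by auto
  moreover have "coord \<beta> \<alpha> \<ge> 0" using a b by (simp add: pos_def)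
  ultimately have "coord \<beta> \<alpha> = 1" by auto
  then show False using e ne by simp
qed

section \<open>The Weyl group and its generation by simple reflections\<close>

lemma weyl_orthogonal: "w \<in> W \<Longrightarrow> orthogonal_transformation w"
proof (induction rule: weyl_group.induct)
  case one
  then show ?case by (simp add: orthogonal_transformation_def linear_iff)
next
  case (mult \<alpha> w)
  then show ?case
    using root_nonzero by (intro orthogonal_transformation_compose orthogonal_root_reflection) auto
qed

lemma weyl_bij: "w \<in> W \<Longrightarrow> bij w"
  using weyl_orthogonal orthogonal_transformation_bij by blast

lemma weyl_root: "w \<in> W \<Longrightarrow> \<beta> \<in> \<Phi> \<Longrightarrow> w \<beta> \<in> \<Phi>"
  by (induction rule: weyl_group.induct) (auto simp: reflection_root)

lemma weyl_minus: "w \<in> W \<Longrightarrow> w (- x) = - w x"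
  by (rule linear_neg[OF orthogonal_transformation_linear[OF weyl_orthogonal]])

lemma weyl_comp: "w \<in> W \<Longrightarrow> x \<in> W \<Longrightarrow> w \<circ> x \<in> W"
  by (induction rule: weyl_group.induct) (auto simp: comp_assoc intro: weyl_group.mult)

lemma reflection_weyl: "\<alpha> \<in> \<Phi> \<Longrightarrow> root_reflection \<alpha> \<in> W"
  using weyl_group.mult[OF _ weyl_group.one] by simp

lemma simple_weyl: "S \<subseteq> W"
  using base_roots reflection_weyl by (auto simp: simple_reflections_def)

lemma simple_involution:
  assumes "s \<in> S" shows "s \<circ> s = id"
proof -
  obtain \<alpha> where "\<alpha> \<in> \<Delta>" "s = root_reflection \<alpha>"
    using assms by (auto simp: simple_reflections_def)
  then show ?thesis using root_nonzero[of \<alpha>] base_roots root_reflection_involution[of \<alpha>] by blast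
qed

lemma wd_weyl: "set ss \<subseteq> S \<Longrightarrow> wd ss \<in> W"
  using simple_weyl by (induction ss) (simp_all add: weyl_comp weyl_group.one subset_iff)

lemma wd_rev: "set ss \<subseteq> S \<Longrightarrow> wd ss \<circ> wd (rev ss) = id"
proof (induction ss)
  case (Cons s ss)
  have "wd (s # ss) \<circ> wd (rev (s # ss)) = s \<circ> (wd ss \<circ> wd (rev ss)) \<circ> s"
    by (simp add: comp_assoc)
  also have "wd ss \<circ> wd (rev ss) = id" using Cons.prems by (intro Cons.IH) simp
  also have "s \<circ> id \<circ> s = id" using simple_involution Cons.prems by simp
  finally show ?case .
qed simp

lemma inv_wd: "set ss \<subseteq> S \<Longrightarrow> inv (wd ss) = wd (rev ss)"
  using wd_rev[of ss] wd_rev[of "rev ss"] by (intro inv_unique_comp) auto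

text \<open>Descent on the height, the sum of the coordinates: a counterexample of least height can
  be reflected in a simple root to a positive root of smaller height.\<close>

lemma pos_root_generated: "pos \<beta> \<Longrightarrow> \<exists>ss \<alpha>. set ss \<subseteq> S \<and> \<alpha> \<in> \<Delta> \<and> \<beta> = wd ss \<alpha>"
proof (rule ccontr)
  define good where "good \<beta> \<longleftrightarrow> (\<exists>ss \<alpha>. set ss \<subseteq> S \<and> \<alpha> \<in> \<Delta> \<and> \<beta> = wd ss \<alpha>)" for \<beta>
  define height where "height \<beta> = (\<Sum>\<gamma>\<in>\<Delta>. coord \<beta> \<gamma>)" for \<beta>
  define B where "B = {\<beta>. pos \<beta> \<and> \<not> good \<beta>}"
  assume "pos \<beta>" "\<nexists>ss \<alpha>. set ss \<subseteq> S \<and> \<alpha> \<in> \<Delta> \<and> \<beta> = wd ss \<alpha>"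
  then have "B \<noteq> {}" by (auto simp: B_def good_def)
  moreover have "finite B"
    using finite_roots by (rule rev_finite_subset) (auto simp: B_def pos_def)
  ultimately obtain \<delta> where d: "\<delta> \<in> B" "\<And>\<epsilon>. \<epsilon> \<in> B \<Longrightarrow> height \<delta> \<le> height \<epsilon>"
    using arg_min_if_finite[of B height] by (metis not_le)
  have p: "pos \<delta>" and b: "\<not> good \<delta>" using d by (auto simp: B_def)
  have "\<delta> \<notin> \<Delta>"
  proof
    assume "\<delta> \<in> \<Delta>"
    then have "good \<delta>" unfolding good_def by (intro exI[of _ "[]"] exI[of _ \<delta>]) simp
    then show False using b by simp
  qed
  \<comment> \<open>Expanding one factor of the positive number \<delta> \<bullet> \<delta> in the
    base yields a simple root \<gamma> with \<gamma> \<bullet> \<delta> > 0, because the coordinates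
    are nonnegative. Reflecting in \<gamma> therefore lowers the height.\<close>
  have "0 < \<delta> \<bullet> \<delta>" using root_nonzero pos_root[OF p] by simp
  also have "\<delta> \<bullet> \<delta> = (\<Sum>\<gamma>\<in>\<Delta>. coord \<delta> \<gamma> *\<^sub>R \<gamma>) \<bullet> \<delta>" by (simp add: sum_coord pos_root[OF p])
  also have "\<dots> = (\<Sum>\<gamma>\<in>\<Delta>. coord \<delta> \<gamma> * (\<gamma> \<bullet> \<delta>))" by (simp add: inner_sum_left)
  finally obtain \<gamma> where g: "\<gamma> \<in> \<Delta>" "0 < coord \<delta> \<gamma> * (\<gamma> \<bullet> \<delta>)"
    by (meson not_le sum_nonpos)
  moreover have "0 \<le> coord \<delta> \<gamma>" using p g by (simp add: pos_def)
  ultimately have pg: "0 < \<gamma> \<bullet> \<delta>" by (simp add: zero_less_mult_iff)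
  have gg: "0 < \<gamma> \<bullet> \<gamma>" using root_nonzero base_roots g by auto
  have "pos (root_reflection \<gamma> \<delta>)"
    using simple_reflection_pos g p \<open>\<delta> \<notin> \<Delta>\<close> by metis
  moreover have "height (root_reflection \<gamma> \<delta>) = height \<delta> - 2 * (\<delta> \<bullet> \<gamma>) / (\<gamma> \<bullet> \<gamma>)"
    using g finite_base
    by (simp add: height_def coord_reflection pos_root[OF p] sum_subtractf del: times_divide_eq_right)
  then have "height (root_reflection \<gamma> \<delta>) < height \<delta>"
    using pg gg by (simp add: inner_commute)
  ultimately have "good (root_reflection \<gamma> \<delta>)" using d by (force simp: B_def)
  then obtain ss \<alpha> where s: "set ss \<subseteq> S" "\<alpha> \<in> \<Delta>" "root_reflection \<gamma> \<delta> = wd ss \<alpha>"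
    by (auto simp: good_def)
  have "\<delta> = (root_reflection \<gamma> \<circ> root_reflection \<gamma>) \<delta>"
    using root_reflection_involution g base_roots root_nonzero by (metis id_apply subsetD)
  also have "\<dots> = wd (root_reflection \<gamma> # ss) \<alpha>" using s by simp
  finally have "good \<delta>" unfolding good_def using s g
    by (intro exI[of _ "root_reflection \<gamma> # ss"]) (auto simp: simple_reflections_def)
  then show False using b by simp
qed

lemma reflection_conj: "w \<in> W \<Longrightarrow> w \<circ> root_reflection \<alpha> \<circ> inv w = root_reflection (w \<alpha>)"
proof -
  assume w: "w \<in> W"
  have "w \<circ> inv w = id" using surj_iff[THEN iffD1, OF bij_is_surj[OF weyl_bij[OF w]]] .
  then show ?thesis
    using orthogonal_comp_root_reflection[OF weyl_orthogonal[OF w], of \<alpha>] by (simp add: comp_assoc)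
qed

text \<open>Every root is, up to sign, the image of a simple root under a word, and the sign does
  not affect the reflection. This gives both the generation of \<open>W\<close> by \<open>S\<close>
  and the description of all reflections by roots.\<close>

lemma reflection_generated:
  assumes "\<beta> \<in> \<Phi>"
  shows "\<exists>ss s. set ss \<subseteq> S \<and> s \<in> S \<and> root_reflection \<beta> = wd ss \<circ> s \<circ> wd (rev ss)"
proof -
  obtain \<delta> where d: "pos \<delta>" "root_reflection \<beta> = root_reflection \<delta>"
    using pos_or_neg[OF assms] root_reflection_minus by metis
  obtain ss \<alpha> where s: "set ss \<subseteq> S" "\<alpha> \<in> \<Delta>" "\<delta> = wd ss \<alpha>" using pos_root_generated d by blast
  have "root_reflection \<delta> = wd ss \<circ> root_reflection \<alpha> \<circ> wd (rev ss)"
    using reflection_conj[OF wd_weyl[OF s(1)], of \<alpha>] s by (simp add: inv_wd)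
  then show ?thesis using d s by (auto simp: simple_reflections_def)
qed

lemma weyl_word: "w \<in> W \<Longrightarrow> \<exists>ss. set ss \<subseteq> S \<and> w = wd ss"
proof (induction rule: weyl_group.induct)
  case one
  then show ?case by (intro exI[of _ "[]"]) simp
next
  case (mult \<alpha> w)
  obtain ts s where "set ts \<subseteq> S" "s \<in> S" "root_reflection \<alpha> = wd ts \<circ> s \<circ> wd (rev ts)"
    using reflection_generated mult by meson
  moreover obtain us where "set us \<subseteq> S" "w = wd us" using mult by blast
  ultimately
  show ?case
    by (intro exI[of _ "ts @ [s] @ rev ts @ us"]) (auto simp: comp_assoc)
qed

section \<open>Reduced words, the exchange condition and lengths\<close>

lemma reduced_word:
  assumes "w \<in> W"
  obtains ss where "set ss \<subseteq> S" "length ss = len w" "w = wd ss"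
proof -
  obtain ss where "set ss \<subseteq> S" "w = wd ss" using weyl_word[OF assms] by (elim exE conjE)
  then show ?thesis by (rule word_length_witness) (rule that)
qed

lemma inv_weyl:
  assumes "w \<in> W" shows "inv w \<in> W"
proof -
  obtain ss where s: "set ss \<subseteq> S" "w = wd ss" using weyl_word[OF assms] by (elim exE conjE)
  then show ?thesis using inv_wd[OF s(1)] wd_weyl[of "rev ss"] by simp
qed

lemma len_inv: 
  assumes "w \<in> W" shows "len (inv w) = len w"
proof -
  have *: "len (inv w) \<le> len w" if w: "w \<in> W" for w
  proof -
    obtain ss where s: "set ss \<subseteq> S" "length ss = len w" "w = wd ss" using w by (rule reduced_word)
    then show ?thesis using inv_wd[OF s(1)] word_length_le[of "rev ss" S] by simp
  qed
  show ?thesis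
    using *[OF assms] *[OF inv_weyl[OF assms]] weyl_bij[OF assms] by (simp add: inv_inv_eq)
qed

text \<open>The first suffix of the word that makes \<open>\<beta>\<close> negative is cut off from its predecessor by a simple
  reflection, whose root must be the image of \<open>\<beta>\<close>.\<close>

lemma exchange:
  assumes "set ss \<subseteq> S" "pos \<beta>" "pos (- wd ss \<beta>)"
  shows "\<exists>us x vs. ss = us @ x # vs \<and> wd ss \<circ> root_reflection \<beta> = wd (us @ vs)"
  using assms
proof (induction ss)
  case Nil
  then show ?case using not_pos_and_neg[of \<beta>] by (metis wd_Nil id_apply)
next
  case (Cons s ss)
  show ?case
  proof (cases "pos (- wd ss \<beta>)")
    case True
    have "set ss \<subseteq> S" using Cons.prems by simp
    from Cons.IH[OF this Cons.prems(2) True]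
    obtain us x vs where u: "ss = us @ x # vs" "wd ss \<circ> root_reflection \<beta> = wd (us @ vs)"
      by (elim exE conjE)
    have "wd (s # ss) \<circ> root_reflection \<beta> = wd ((s # us) @ vs)"
      by (simp only: wd_Cons comp_assoc u(2) append_Cons)
    then show ?thesis using u(1) by (metis append_Cons)
  next
    case False
    have w: "wd ss \<in> W" using Cons by (simp add: wd_weyl)
    have p: "pos (wd ss \<beta>)"
      using False pos_or_neg weyl_root[OF w] pos_root Cons.prems by blast
    obtain \<alpha> where a: "\<alpha> \<in> \<Delta>" "s = root_reflection \<alpha>"
      using Cons.prems by (auto simp: simple_reflections_def)
    have "\<not> pos (s (wd ss \<beta>))" using Cons.prems(3) not_pos_and_neg[of "s (wd ss \<beta>)"] by auto
    then have "wd ss \<beta> = \<alpha>" using simple_reflection_pos a p by metis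
    then have "wd ss \<circ> root_reflection \<beta> = s \<circ> wd ss"
      using orthogonal_comp_root_reflection[OF weyl_orthogonal[OF w]] a by simp
    then have "wd (s # ss) \<circ> root_reflection \<beta> = s \<circ> s \<circ> wd ss" by (simp only: wd_Cons comp_assoc)
    also have "s \<circ> s = id" using simple_involution Cons.prems by simp
    finally have "wd (s # ss) \<circ> root_reflection \<beta> = wd ss" by (simp only: id_comp)
    then show ?thesis by (intro exI[of _ "[]"] exI[of _ s] exI[of _ ss] conjI) (simp_all only: append_Nil)
  qed
qed

text \<open>The reversed word represents the inverse element, so \<open>exchange\<close> for the
  reversed word is the left-handed version after inversion.\<close>

lemma left_exchange:
  assumes s: "set ss \<subseteq> S" and b: "pos \<beta>" and n: "pos (- inv (wd ss) \<beta>)"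
  shows "\<exists>us x vs. ss = us @ x # vs \<and> root_reflection \<beta> \<circ> wd ss = wd (us @ vs)"
proof -
  have r: "set (rev ss) \<subseteq> S" using s by simp
  from exchange[OF r b n[unfolded inv_wd[OF s]]]
  obtain us x vs where e: "rev ss = us @ x # vs" "wd (rev ss) \<circ> root_reflection \<beta> = wd (us @ vs)"
    by (elim exE conjE)
  have ss: "ss = rev vs @ x # rev us" using arg_cong[OF e(1), of rev] by simp
  have i: "root_reflection \<beta> \<circ> root_reflection \<beta> = id"
    using root_reflection_involution root_nonzero pos_root b by blast
  have uv: "set (us @ vs) \<subseteq> S" using s ss by auto
  \<comment> \<open>The identity is inserted as the shortened word times its reverse; substituting
    \<open>e(2)\<close> for the shortened word then makes everything but the reverse cancel.\<close>
  have "root_reflection \<beta> \<circ> wd ss = root_reflection \<beta> \<circ> wd ss \<circ> (wd (us @ vs) \<circ> wd (rev (us @ vs)))"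
    using wd_rev[OF uv] by simp
  also have "\<dots> = root_reflection \<beta> \<circ> (wd ss \<circ> wd (rev ss)) \<circ> root_reflection \<beta> \<circ> wd (rev (us @ vs))"
    by (simp only: e(2)[symmetric] comp_assoc)
  also have "\<dots> = root_reflection \<beta> \<circ> root_reflection \<beta> \<circ> wd (rev (us @ vs))"
    by (simp only: wd_rev[OF s] comp_id)
  also have "\<dots> = wd (rev vs @ rev us)" by (simp only: i id_comp rev_append)
  finally show ?thesis using ss by blast
qed

text \<open>Deleting a letter from a reduced word shows that a root made negative by
  \<open>inv w\<close> shortens \<open>w\<close>. The opposite case reduces to this one for the
  reflected element, since the reflection turns \<beta> into its negative; hence the length always
  changes strictly.\<close>

lemma len_reflection:
  assumes w: "w \<in> W" and b: "pos \<beta>"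
  shows "len (root_reflection \<beta> \<circ> w) < len w \<longleftrightarrow> pos (- inv w \<beta>)"
    and "len (root_reflection \<beta> \<circ> w) \<noteq> len w"
proof -
  have *: "len (root_reflection \<beta> \<circ> w) < len w" if w: "w \<in> W" and n: "pos (- inv w \<beta>)" for w
  proof -
    obtain ss where s: "set ss \<subseteq> S" "length ss = len w" "w = wd ss" using w by (rule reduced_word)
    have "pos (- inv (wd ss) \<beta>)" using n s by simp
    from left_exchange[OF s(1) b this]
    obtain us x vs where u: "ss = us @ x # vs" "root_reflection \<beta> \<circ> wd ss = wd (us @ vs)"
      by (elim exE conjE)
    have "len (root_reflection \<beta> \<circ> w) \<le> length (us @ vs)" 
      using u s word_length_le[of "us @ vs" S] by auto
    then show ?thesis using u s by simp
  qed
  have i: "root_reflection \<beta> \<circ> root_reflection \<beta> = id"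
    using root_reflection_involution root_nonzero pos_root b by blast
  have **: "len w < len (root_reflection \<beta> \<circ> w)" if n: "\<not> pos (- inv w \<beta>)"
  proof -
    let ?r = "root_reflection \<beta>"
    have "inv (?r \<circ> w) = inv w \<circ> inv ?r"
      using w weyl_bij reflection_weyl pos_root b by (intro o_inv_distrib) auto
    moreover have "inv ?r = ?r" using i by (intro inv_unique_comp) auto
    moreover have "?r \<beta> = - \<beta>" using root_reflection_self root_nonzero pos_root b by blast
    ultimately have "- inv (?r \<circ> w) \<beta> = inv w \<beta>"
      using weyl_minus[OF inv_weyl[OF w], of \<beta>] by simp
    moreover have "pos (inv w \<beta>)" using n pos_or_neg weyl_root inv_weyl w pos_root b by blast
    ultimately have "len (?r \<circ> (?r \<circ> w)) < len (?r \<circ> w)"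
      using * weyl_comp reflection_weyl w pos_root b by auto
    then show ?thesis by (simp only: o_assoc i id_comp)
  qed
  show "len (root_reflection \<beta> \<circ> w) < len w \<longleftrightarrow> pos (- inv w \<beta>)"
    using *[OF w] ** by force
  show "len (root_reflection \<beta> \<circ> w) \<noteq> len w"
    using *[OF w] ** by force
qed

text \<open>A further letter raises the length by at most one. Multiplying twice by \<open>s\<close>
  gives the same bound in the other direction, and equality of lengths is excluded by
  \<open>len_reflection\<close>.\<close>

lemma len_simple:
  assumes "w \<in> W" "s \<in> S"
  shows "len (s \<circ> w) = Suc (len w) \<or> len w = Suc (len (s \<circ> w))"
proof -
  have le: "len (s \<circ> x) \<le> Suc (len x)" if x: "x \<in> W" for x
  proof -
    obtain ss where "set ss \<subseteq> S" "length ss = len x" "x = wd ss" using x by (rule reduced_word)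
    then show ?thesis using word_length_le[of "s # ss" S] assms by simp
  qed
  have "s \<circ> (s \<circ> w) = w" by (simp only: o_assoc simple_involution[OF assms(2)] id_comp)
  moreover have "s \<circ> w \<in> W" using weyl_comp simple_weyl assms by blast
  ultimately have "len w \<le> Suc (len (s \<circ> w))" using le[of "s \<circ> w"] by simp
  moreover have "len (s \<circ> w) \<noteq> len w"
    using assms pos_base len_reflection(2) by (auto simp: simple_reflections_def)
  ultimately show ?thesis using le[OF assms(1)] by auto
qed

section \<open>The Bruhat order and its lifting property\<close>

lemma group_reflections_eq: "group_reflections W S = root_reflection ` \<Phi>"
proof (intro equalityI subsetI)
  fix t assume "t \<in> group_reflections W S"
  then obtain x \<alpha> where "x \<in> W" "\<alpha> \<in> \<Delta>" "t = x \<circ> root_reflection \<alpha> \<circ> inv x"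
    by (auto simp: group_reflections_def simple_reflections_def)
  then show "t \<in> root_reflection ` \<Phi>"
    using reflection_conj weyl_root base_roots by auto
next
  fix t assume "t \<in> root_reflection ` \<Phi>"
  then obtain ss s where "set ss \<subseteq> S" "s \<in> S" "t = wd ss \<circ> s \<circ> wd (rev ss)"
    using reflection_generated by blast
  then show "t \<in> group_reflections W S"
    unfolding group_reflections_def
    by (intro CollectI exI[of _ "wd ss"] exI[of _ s] conjI) (simp_all only: inv_wd wd_weyl)
qed

text \<open>One step of the chains defining the Bruhat order, with the reflection given by a
  positive root, the form in which the exchange condition applies.\<close>

definition step :: "('a \<Rightarrow> 'a) \<Rightarrow> ('a \<Rightarrow> 'a) \<Rightarrow> bool" where
  "step y w \<longleftrightarrow> (\<exists>\<beta>. pos \<beta> \<and> w = root_reflection \<beta> \<circ> y \<and> len y < len w)"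

lemma le_eq_steps: "le = step\<^sup>*\<^sup>*"
proof -
  have "(\<exists>t\<in>group_reflections W S. w = t \<circ> y \<and> len y < len w) \<longleftrightarrow> step y w" for y w
    unfolding step_def group_reflections_eq using pos_or_neg pos_root root_reflection_minus
    by (metis (no_types, lifting) imageE imageI)
  then show ?thesis unfolding bruhat_le_def by presburger
qed

lemma le_refl [simp]: "le w w"
  by (simp add: le_eq_steps)

lemma le_trans: "le x y \<Longrightarrow> le y z \<Longrightarrow> le x z"
  by (simp add: le_eq_steps)

lemma le_len: "le y w \<Longrightarrow> y = w \<or> len y < len w"
  unfolding le_eq_steps by (induction rule: rtranclp_induct) (auto simp: step_def)

lemma step_weyl: "step y w \<Longrightarrow> y \<in> W \<Longrightarrow> w \<in> W"
  using weyl_comp reflection_weyl pos_root by (auto simp: step_def)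

lemma le_simple:
  assumes "w \<in> W" "s \<in> S" "len w < len (s \<circ> w)"
  shows "le w (s \<circ> w)"
proof -
  have "step w (s \<circ> w)"
    unfolding step_def using assms pos_base by (auto simp: simple_reflections_def)
  then show ?thesis by (simp add: le_eq_steps)
qed

text \<open>Moving the reflection past \<open>inv y\<close> turns right multiplication back into
  left multiplication by a reflection. This makes inversion monotone for the Bruhat order and
  transfers left-handed facts to the right.\<close>

lemma step_inv:
  assumes "step y w" "y \<in> W"
  shows "step (inv y) (inv w)"
proof -
  obtain \<beta> where b: "pos \<beta>" "w = root_reflection \<beta> \<circ> y" "len y < len w"
    using assms by (auto simp: step_def)
  let ?r = "root_reflection \<beta>"
  have r: "\<beta> \<in> \<Phi>" using b pos_root by simp
  have i: "inv ?r = ?r"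
    using root_reflection_involution root_nonzero r by (intro inv_unique_comp) auto
  have "inv w = inv y \<circ> inv ?r"
    unfolding b using weyl_bij reflection_weyl r assms by (intro o_inv_distrib) auto
  also have "\<dots> = root_reflection (inv y \<beta>) \<circ> inv y"
    using orthogonal_comp_root_reflection weyl_orthogonal inv_weyl assms i by metis
  finally have e: "inv w = root_reflection (inv y \<beta>) \<circ> inv y" .
  have "inv y \<beta> \<in> \<Phi>" using weyl_root inv_weyl assms r by blast
  then obtain \<gamma> where "pos \<gamma>" "root_reflection (inv y \<beta>) = root_reflection \<gamma>"
    using pos_or_neg root_reflection_minus by metis
  moreover have "len (inv y) < len (inv w)" using b len_inv assms step_weyl by metis
  ultimately show ?thesis using e by (auto simp: step_def)
qed

lemma le_inv: "le y w \<Longrightarrow> y \<in> W \<Longrightarrow> le (inv y) (inv w)"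
proof -
  assume "le y w" "y \<in> W"
  then have "le (inv y) (inv w) \<and> w \<in> W" unfolding le_eq_steps
  proof (induction rule: rtranclp_induct)
    case (step z w)
    then show ?case
      using step_inv[of z w] step_weyl[of z w] rtranclp.rtrancl_into_rtrancl by metis
  qed simp
  then show ?thesis by simp
qed

text \<open>Conjugation by \<open>s\<close> makes \<open>s \<circ> w\<close> a reflection of
  \<open>s \<circ> y\<close>, so the two lengths differ. If the length goes up, this is again a
  step; if it goes down, the exchange condition deletes a letter from \<open>s\<close> followed by a
  reduced word of \<open>y\<close>.\<close>

lemma step_lift:
  assumes st: "step y w" and y: "y \<in> W" and s: "s \<in> S"
  shows "step (s \<circ> y) (s \<circ> w) \<or> s \<circ> y = w"
proof -
  obtain \<beta> where b: "pos \<beta>" "w = root_reflection \<beta> \<circ> y" "len y < len w"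
    using st by (auto simp: step_def)
  have w: "w \<in> W" using st y step_weyl by blast
  have sW: "s \<in> W" using s simple_weyl by blast
  have ss: "s \<circ> s = id" using simple_involution s by simp
  obtain \<gamma> where g: "pos \<gamma>" "root_reflection (s \<beta>) = root_reflection \<gamma>"
    using pos_or_neg weyl_root sW pos_root b root_reflection_minus by metis
  have "s \<circ> root_reflection \<beta> = root_reflection \<gamma> \<circ> s"
    using orthogonal_comp_root_reflection weyl_orthogonal sW g by metis
  then have e: "s \<circ> w = root_reflection \<gamma> \<circ> (s \<circ> y)" unfolding b(2) by (simp only: o_assoc)
  have sy: "s \<circ> y \<in> W" using weyl_comp sW y by simp
  show ?thesis
  proof (cases "len (s \<circ> y) < len (s \<circ> w)")
    case True
    then show ?thesis using e g by (auto simp: step_def)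
  next
    case False
    then have lt: "len (s \<circ> w) < len (s \<circ> y)"
      using e g len_reflection(2)[OF sy g(1)] by simp
    obtain ts where t: "set ts \<subseteq> S" "length ts = len y" "y = wd ts" using y by (rule reduced_word)
    have n: "pos (- inv (wd (s # ts)) \<gamma>)"
      using lt e len_reflection(1)[OF sy g(1)] t by simp
    have "set (s # ts) \<subseteq> S" using s t by simp
    from left_exchange[OF this g(1) n]
    obtain us x vs where u: "s # ts = us @ x # vs"
      "root_reflection \<gamma> \<circ> wd (s # ts) = wd (us @ vs)"
      by (elim exE conjE)
    have "root_reflection \<gamma> \<circ> wd (s # ts) = s \<circ> w" unfolding e t wd_Cons ..
    then have u2: "s \<circ> w = wd (us @ vs)" using u(2) by (rule trans[OF sym])
    show ?thesis
    proof (cases us)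
      \<comment> \<open>The deleted letter is the leading \<open>s\<close>, hence
        \<open>s \<circ> w = y\<close>.\<close>
      case Nil
      then have "s \<circ> (s \<circ> w) = s \<circ> y" using u(1) u2 t by simp
      then have "w = s \<circ> y" by (simp only: o_assoc ss id_comp)
      then show ?thesis by simp
    next
      \<comment> \<open>The deleted letter lies in the reduced word of \<open>y\<close>, so
        \<open>w\<close> has a word shorter than \<open>len y\<close>, against
        \<open>len y < len w\<close>.\<close>
      case (Cons a us')
      then have "s \<circ> (s \<circ> w) = s \<circ> (s \<circ> wd (us' @ vs))" using u(1) u2 by simp
      then have "w = wd (us' @ vs)" by (simp only: o_assoc ss id_comp)
      then have "len w \<le> length (us' @ vs)"
        using word_length_le[of "us' @ vs" S] t u Cons by auto
      then show ?thesis using b t u Cons by simp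
    qed
  qed
qed

text \<open>Induction along the chain from its lower end: a step either lifts to the multiples by
  \<open>s\<close>, or is itself multiplication by \<open>s\<close>, in which case the rest of the
  chain already leads to \<open>w\<close>.\<close>

lemma le_lift:
  assumes "le y w" "y \<in> W" "s \<in> S"
  shows "le (s \<circ> y) w \<or> le (s \<circ> y) (s \<circ> w)"
  using assms unfolding le_eq_steps
proof (induction rule: converse_rtranclp_induct)
  case (step y z)
  have z: "z \<in> W" using step step_weyl by blast
  show ?case
    using step_lift[OF step(1,4,5)] step.IH[OF z] step.hyps step.prems
    by (metis converse_rtranclp_into_rtranclp)
qed simp

lemma le_lift_right:
  assumes "le y w" "y \<in> W" "w \<in> W" "s \<in> S"
  shows "le (y \<circ> s) w \<or> le (y \<circ> s) (w \<circ> s)"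
proof -
  have sW: "s \<in> W" using assms simple_weyl by blast
  have invs: "inv s = s" using simple_involution assms by (intro inv_unique_comp) auto
  have "le (s \<circ> inv y) (inv w) \<or> le (s \<circ> inv y) (s \<circ> inv w)"
    using le_lift le_inv inv_weyl assms by blast
  moreover have "s \<circ> inv y \<in> W" using weyl_comp inv_weyl assms sW by blast
  moreover have "inv (s \<circ> inv x) = x \<circ> s" if "x \<in> W" for x
    using o_inv_distrib[of s "inv x"] weyl_bij sW inv_weyl that invs by (simp add: inv_inv_eq)
  ultimately show ?thesis
    using le_inv assms weyl_bij inv_inv_eq by metis
qed

text \<open>There are only finitely many words of bounded length in the finite set \<open>S\<close>.
  This makes lower Bruhat intervals finite.\<close>

lemma finite_len_le: "finite {w \<in> W. len w \<le> n}"
proof (rule finite_subset)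
  have "finite S" by (simp add: simple_reflections_def finite_base)
  then show "finite (wd ` {ss. set ss \<subseteq> S \<and> length ss \<le> n})"
    by (intro finite_imageI finite_lists_length_le)
  show "{w \<in> W. len w \<le> n} \<subseteq> wd ` {ss. set ss \<subseteq> S \<and> length ss \<le> n}"
  proof
    fix w assume w: "w \<in> {w \<in> W. len w \<le> n}"
    then have "w \<in> W" by simp
    then obtain ss where "set ss \<subseteq> S" "length ss = len w" "w = wd ss" by (rule reduced_word)
    then show "w \<in> wd ` {ss. set ss \<subseteq> S \<and> length ss \<le> n}" using w by auto
  qed
qed

end

section \<open>Laurent polynomials and triangular semilinear involutions\<close>

abbreviation (input) lookup where "lookup \<equiv> Poly_Mapping.lookup"
abbreviation (input) keys where "keys \<equiv> Poly_Mapping.keys"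

section \<open>Laurent polynomials in \<open>v\<close> and the substitution of \<open>v^-1\<close>
  for \<open>v\<close>\<close>

text \<open>Additively, Laurent polynomials are the free abelian group on their exponents, so
  induction for free abelian groups applies.\<close>

lemma laurent_induct [case_names zero vpow diff]:
  assumes "P 0" and "\<And>n. P (vpow n)" and "\<And>a b. P a \<Longrightarrow> P b \<Longrightarrow> P (a - b)"
  shows "P (p :: laurent)"
  by (rule frag_induction[of p UNIV]) (use assms in \<open>auto simp: vpow_def\<close>)

lemma lookup_vpow: "lookup (vpow n) k = (if k = n then 1 else 0)"
  by (simp add: vpow_def lookup_single when_def)

lemma lookup_vpow_mult: "lookup (vpow n * p) k = lookup p (k - n)"
  by (induction p arbitrary: k rule: laurent_induct)
    (auto simp: right_diff_distrib lookup_minus vpow_def mult_single lookup_single when_def)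

lemma lookup_mult_vpow: "lookup (p * vpow n) k = lookup p (k - n)"
  by (simp add: mult.commute[of p] lookup_vpow_mult)

lemma vpow_add: "vpow m * vpow n = vpow (m + n)"
  by (simp add: vpow_def mult_single)

lemma vpow_0 [simp]: "vpow 0 = 1"
  by (simp add: vpow_def)

lemma lookup_mult_nonzero:
  assumes "lookup (p * q :: laurent) k \<noteq> 0"
  obtains i j where "lookup p i \<noteq> 0" "lookup q j \<noteq> 0" "k = i + j"
proof -
  have "k \<in> keys (p * q)" using assms by (simp add: in_keys_iff)
  then show ?thesis using keys_mult[of p q] that by (auto simp: in_keys_iff)
qed

definition lbar :: "laurent \<Rightarrow> laurent" where
  "lbar p = Poly_Mapping.map_key uminus p"

lemma lookup_lbar [simp]: "lookup (lbar p) k = lookup p (- k)"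
  unfolding lbar_def by (subst map_key.rep_eq) auto

lemma lbar_0 [simp]: "lbar 0 = 0"
  and lbar_diff: "lbar (p - q) = lbar p - lbar q"
  and lbar_vpow: "lbar (vpow n) = vpow (- n)"
  and lbar_lbar [simp]: "lbar (lbar p) = p"
  by (rule poly_mapping_eqI; force simp: lookup_minus lookup_vpow)+

text \<open>Supplies the part of a coefficient of low degree that is split off in the
  Kazhdan--Lusztig argument.\<close>

lemma laurent_truncate: "\<exists>e :: laurent. \<forall>k. lookup e k = (if k < N then lookup d k else 0)"
proof -
  have "finite {k. (if k < N then lookup d k else 0) \<noteq> 0}"
    by (rule finite_subset[of _ "keys d"]) (auto simp: in_keys_iff)
  then show ?thesis
    by (intro exI[of _ "Abs_poly_mapping (\<lambda>k. if k < N then lookup d k else 0)"]) simp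
qed

lemma u_poly_pCons: "u_poly (pCons a p) = of_int a + vpow 2 * u_poly p"
  by (simp add: u_poly_def upow_def map_poly_pCons)

lemma lookup_u_poly:
  "lookup (u_poly p) k = (if 0 \<le> k \<and> even k then poly.coeff p (nat (k div 2)) else 0)"
proof (induction p arbitrary: k)
  case 0
  then show ?case by (simp add: u_poly_def)
next
  case (pCons a p)
  have "nat (k div 2) = Suc (nat ((k - 2) div 2))" if "k \<ge> 2" using that by simp
  moreover have "k = 0 \<or> k \<ge> 2" if "k \<ge> 0" "even k" using that by presburger
  ultimately show ?case
    by (auto simp: u_poly_pCons lookup_add lookup_of_int lookup_vpow_mult pCons.IH when_def)
qed

text \<open>Recognizes the image of \<int>[u] by exponents. The coefficient of the
  \<open>n\<close>-th power of \<open>u\<close> is read at exponent \<open>2 * n\<close> of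
  \<open>v\<close>, and finiteness of the support provides the bound that \<open>Abs_poly\<close>
  requires.\<close>

lemma u_poly_exists:
  assumes "\<And>k. lookup q k \<noteq> 0 \<Longrightarrow> 0 \<le> k \<and> even k"
  shows "\<exists>p. u_poly p = q"
proof -
  have "finite ((\<lambda>k. nat (k div 2)) ` keys q)" by simp
  then obtain N where N: "\<And>k. k \<in> keys q \<Longrightarrow> nat (k div 2) < N"
    by (metis finite_nat_set_iff_bounded imageI)
  have "lookup q (2 * int n) = 0" if "n > N" for n
    using N[of "2 * int n"] that by (force simp: in_keys_iff)
  then have c: "poly.coeff (Abs_poly (\<lambda>n. lookup q (2 * int n))) = (\<lambda>n. lookup q (2 * int n))"
    by (intro coeff_Abs_poly[of N]) auto
  have "u_poly (Abs_poly (\<lambda>n. lookup q (2 * int n))) = q"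
  proof (rule poly_mapping_eqI)
    fix k
    show "lookup (u_poly (Abs_poly (\<lambda>n. lookup q (2 * int n)))) k = lookup q k"
      using assms[of k] by (auto simp: lookup_u_poly c)
  qed
  then show ?thesis by blast
qed

section \<open>Free modules and semilinear maps on them\<close>

lemma lookup_basis_elt: "lookup (basis_elt w) y = (if y = w then 1 else 0)"
  by (simp add: basis_elt_def lookup_single when_def)

lemma free_module_v_iff: "m \<in> free_module_v I \<longleftrightarrow> (\<forall>y. lookup m y \<noteq> 0 \<longrightarrow> y \<in> I)"
  by (auto simp: free_module_v_def in_keys_iff)

text \<open>The index set may be larger than the support, so that the sum can run over a whole
  Bruhat interval.\<close>

lemma basis_expansion:
  assumes "finite K" "\<And>y. lookup m y \<noteq> 0 \<Longrightarrow> y \<in> K"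
  shows "m = (\<Sum>y\<in>K. lookup m y *\<^sub>L basis_elt y)"
proof (rule poly_mapping_eqI)
  fix x
  have "(\<Sum>y\<in>K. lookup m y * lookup (basis_elt y) x) = (\<Sum>y\<in>K. if y = x then lookup m x else 0)"
    by (rule sum.cong) (auto simp: lookup_basis_elt)
  then show "lookup m x = lookup (\<Sum>y\<in>K. lookup m y *\<^sub>L basis_elt y) x"
    using assms by (auto simp: lookup_sum)
qed

lemma free_module_v_closed:
  shows "0 \<in> free_module_v I"
    and "m \<in> free_module_v I \<Longrightarrow> m' \<in> free_module_v I \<Longrightarrow> m + m' \<in> free_module_v I"
    and "m \<in> free_module_v I \<Longrightarrow> m' \<in> free_module_v I \<Longrightarrow> m - m' \<in> free_module_v I"
    and "m \<in> free_module_v I \<Longrightarrow> c *\<^sub>L m \<in> free_module_v I"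
    and "w \<in> I \<Longrightarrow> basis_elt w \<in> free_module_v I"
proof -
  have "m \<in> free_module_v I \<longleftrightarrow> (\<forall>y. y \<notin> I \<longrightarrow> lookup m y = 0)" for m
    by (auto simp: free_module_v_iff)
  note iff = this
  show "0 \<in> free_module_v I"
    and "m \<in> free_module_v I \<Longrightarrow> m' \<in> free_module_v I \<Longrightarrow> m + m' \<in> free_module_v I"
    and "m \<in> free_module_v I \<Longrightarrow> m' \<in> free_module_v I \<Longrightarrow> m - m' \<in> free_module_v I"
    and "m \<in> free_module_v I \<Longrightarrow> c *\<^sub>L m \<in> free_module_v I"
    and "w \<in> I \<Longrightarrow> basis_elt w \<in> free_module_v I"
    by (auto simp: iff lookup_add lookup_minus lookup_basis_elt)
qed

lemma finite_has_maximum: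
  fixes l :: "'w \<Rightarrow> nat"
  assumes "finite K" "K \<noteq> {}"
  obtains y where "y \<in> K" "\<And>z. z \<in> K \<Longrightarrow> l z \<le> l y"
proof -
  have "Max (l ` K) \<in> l ` K" using assms by (intro Max_in) auto
  then obtain y where "y \<in> K" "l y = Max (l ` K)" by auto
  then show ?thesis using that[of y] assms(1) by simp
qed

locale semilinear_bar =
  fixes I :: "'w set"
    and bar :: "('w \<Rightarrow>\<^sub>0 laurent) \<Rightarrow> ('w \<Rightarrow>\<^sub>0 laurent)"
  assumes bar_closed: "m \<in> free_module_v I \<Longrightarrow> bar m \<in> free_module_v I"
    and bar_add: "m \<in> free_module_v I \<Longrightarrow> m' \<in> free_module_v I \<Longrightarrow> bar (m + m') = bar m + bar m'"
    and bar_vpow: "m \<in> free_module_v I \<Longrightarrow> bar (vpow n *\<^sub>L m) = vpow (- n) *\<^sub>L bar m"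
begin

abbreviation V where "V \<equiv> free_module_v I"

lemma bar_0: "bar 0 = 0"
  using bar_add[of 0 0] by (simp add: free_module_v_closed)

lemma bar_diff: "m \<in> V \<Longrightarrow> m' \<in> V \<Longrightarrow> bar (m - m') = bar m - bar m'"
  using bar_add[of "m - m'" m'] by (simp add: free_module_v_closed algebra_simps)

text \<open>Semilinearity is assumed only for powers of \<open>v\<close>; additivity extends it to
  all Laurent polynomials.\<close>

lemma bar_lscale:
  assumes "m \<in> V" shows "bar (c *\<^sub>L m) = lbar c *\<^sub>L bar m"
proof (induction c rule: laurent_induct)
  case (diff a b)
  then show ?case
    using assms
    by (simp add: lmod.scale_left_diff_distrib bar_diff free_module_v_closed lbar_diff)
qed (simp_all add: bar_0 bar_vpow lbar_vpow assms)

lemma bar_sum: "(\<And>i. i \<in> K \<Longrightarrow> f i \<in> V) \<Longrightarrow> bar (sum f K) = (\<Sum>i\<in>K. bar (f i))"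
proof (induction K rule: infinite_finite_induct)
  case (insert x K)
  have "sum f K \<in> V"
    using insert.prems
    by (auto simp: free_module_v_iff lookup_sum) (meson insertCI sum.not_neutral_contains_not_neutral)
  then show ?case using insert by (simp add: bar_add)
qed (simp_all add: bar_0)

lemma bar_expansion:
  assumes "m \<in> V"
  shows "bar m = (\<Sum>y\<in>keys m. lbar (lookup m y) *\<^sub>L bar (basis_elt y))"
proof -
  have k: "y \<in> I" if "y \<in> keys m" for y
    using assms that by (auto simp: free_module_v_iff in_keys_iff)
  have "m = (\<Sum>y\<in>keys m. lookup m y *\<^sub>L basis_elt y)"
    by (rule basis_expansion) (auto simp: in_keys_iff)
  then have "bar m = bar (\<Sum>y\<in>keys m. lookup m y *\<^sub>L basis_elt y)" by (rule arg_cong)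
  then show ?thesis
    using k by (simp add: bar_sum bar_lscale free_module_v_closed)
qed

end

section \<open>The Kazhdan--Lusztig argument for a triangular bar map\<close>

text \<open>Exponents are those of \<open>v\<close>: the diagonal coefficient is
  \<open>u^(-l w)\<close>, and the last assumption says that all coefficients lie in
  \<open>u^(-l w)\<close> times \<int>[u].\<close>

locale triangular_bar = semilinear_bar I bar
  for I :: "'w set" and bar :: "('w \<Rightarrow>\<^sub>0 laurent) \<Rightarrow> ('w \<Rightarrow>\<^sub>0 laurent)" +
  fixes le :: "'w \<Rightarrow> 'w \<Rightarrow> bool" and l :: "'w \<Rightarrow> nat"
  assumes le_refl: "le w w"
    and le_trans: "le x y \<Longrightarrow> le y z \<Longrightarrow> le x z"
    and le_len: "le y w \<Longrightarrow> y = w \<or> l y < l w"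
    and finite_below: "w \<in> I \<Longrightarrow> finite {y \<in> I. le y w}"
    and bar_bar_basis: "w \<in> I \<Longrightarrow> bar (bar (basis_elt w)) = basis_elt w"
    and bar_basis_le: "w \<in> I \<Longrightarrow> lookup (bar (basis_elt w)) y \<noteq> 0 \<Longrightarrow> le y w"
    and bar_basis_diag: "w \<in> I \<Longrightarrow> lookup (bar (basis_elt w)) w = vpow (- 2 * int (l w))"
    and bar_basis_exponents: "w \<in> I \<Longrightarrow> lookup (lookup (bar (basis_elt w)) y) k \<noteq> 0 \<Longrightarrow>
      even k \<and> - 2 * int (l w) \<le> k"
begin

lemma bar_bar:
  assumes "m \<in> V" shows "bar (bar m) = m"
proof -
  have k: "y \<in> I" if "y \<in> keys m" for y
    using assms that by (auto simp: free_module_v_iff in_keys_iff)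
  have "bar (bar m) = (\<Sum>y\<in>keys m. lookup m y *\<^sub>L basis_elt y)"
    unfolding bar_expansion[OF assms]
    using k by (simp add: bar_sum bar_lscale free_module_v_closed bar_closed bar_bar_basis)
  also have "\<dots> = m" by (rule basis_expansion[symmetric]) (auto simp: in_keys_iff)
  finally show ?thesis .
qed

text \<open>By triangularity, another \<open>z\<close> in the support could contribute at
  \<open>y\<close> only if \<open>y\<close> lay strictly below \<open>z\<close>, which would make
  \<open>z\<close> longer.\<close>

lemma lookup_bar_maximal:
  assumes "m \<in> V" and y: "y \<in> I" and max: "\<And>z. lookup m z \<noteq> 0 \<Longrightarrow> l z \<le> l y"
  shows "lookup (bar m) y = lbar (lookup m y) * vpow (- 2 * int (l y))"
proof -
  have "lookup (bar m) y = (\<Sum>z\<in>keys m. lbar (lookup m z) * lookup (bar (basis_elt z)) y)"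
    by (simp add: bar_expansion[OF assms(1)] lookup_sum)
  also have "\<dots> = (\<Sum>z\<in>keys m. if z = y then lbar (lookup m y) * vpow (- 2 * int (l y)) else 0)"
  proof (rule sum.cong)
    fix z assume z: "z \<in> keys m"
    then have "z \<in> I" "l z \<le> l y"
      using assms(1) max by (auto simp: free_module_v_iff in_keys_iff)
    then have "lookup (bar (basis_elt z)) y = 0" if "z \<noteq> y"
      using that bar_basis_le[of z y] le_len[of y z] by fastforce
    then show "lbar (lookup m z) * lookup (bar (basis_elt z)) y =
        (if z = y then lbar (lookup m y) * vpow (- 2 * int (l y)) else 0)"
      using y by (auto simp: bar_basis_diag)
  qed simp
  also have "\<dots> = lbar (lookup m y) * vpow (- 2 * int (l y))"
    by (cases "lookup m y = 0") (simp_all add: in_keys_iff)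
  finally show ?thesis .
qed

text \<open>The conditions on the polynomials in terms of the coefficients of \<open>A\<close>.
  After multiplication by \<open>v^(-l w)\<close>, a polynomial in \<open>u\<close> has exponents at
  least \<open>- l w\<close> and of the parity of \<open>l w\<close>, and the degree bound becomes
  strict negativity relative to \<open>- l y\<close>.\<close>

definition canonical :: "'w \<Rightarrow> ('w \<Rightarrow>\<^sub>0 laurent) \<Rightarrow> bool" where
  "canonical w A \<longleftrightarrow> A \<in> V \<and> bar A = A \<and> lookup A w = vpow (- int (l w)) \<and>
     (\<forall>y. lookup A y \<noteq> 0 \<longrightarrow> le y w) \<and>
     (\<forall>y k. y \<noteq> w \<longrightarrow> lookup (lookup A y) k \<noteq> 0 \<longrightarrow>
        k < - int (l y) \<and> - int (l w) \<le> k \<and> even (k + int (l w)))"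

text \<open>At an element \<open>y\<close> of maximal length in the support, bar invariance makes \<open>v\<^sup>l\<^sup>(\<^sup>y\<^sup>)\<close> times the
  coefficient symmetric under \<open>v \<mapsto> v\<^sup>-\<^sup>1\<close>, so it cannot have only negative exponents.\<close>

lemma bar_invariant_negative_zero:
  assumes D: "D \<in> V" "bar D = D" and neg: "\<And>y k. lookup (lookup D y) k \<noteq> 0 \<Longrightarrow> k < - int (l y)"
  shows "D = 0"
proof (rule ccontr)
  assume "D \<noteq> 0"
  then have "keys D \<noteq> {}" by simp
  then obtain y where y: "y \<in> keys D" "\<And>z. z \<in> keys D \<Longrightarrow> l z \<le> l y"
    using finite_has_maximum[of "keys D" l] by auto
  then have "y \<in> I" using D by (auto simp: free_module_v_iff in_keys_iff)
  then have e: "lookup D y = lbar (lookup D y) * vpow (- 2 * int (l y))"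
    using lookup_bar_maximal[OF D(1), of y] y D(2) by (simp add: in_keys_iff)
  have "lookup D y \<noteq> 0" using y by (simp add: in_keys_iff)
  then obtain k where k: "lookup (lookup D y) k \<noteq> 0" by (metis poly_mapping_eqI lookup_zero)
  have "lookup (lookup D y) k = lookup (lookup D y) (- k - 2 * int (l y))"
    by (subst e) (simp add: lookup_mult_vpow algebra_simps)
  then show False using k neg[of y k] neg[of y "- k - 2 * int (l y)"] by simp
qed

text \<open>The prescribed coefficients at \<open>w\<close> cancel in the difference, which is then
  invariant with only negative relative exponents.\<close>

lemma canonical_unique:
  assumes "canonical w A" "canonical w B"
  shows "A = B"
proof -
  have "A - B = 0"
  proof (rule bar_invariant_negative_zero)
    show "A - B \<in> V" "bar (A - B) = A - B"
      using assms by (auto simp: canonical_def free_module_v_closed bar_diff)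
    fix y k assume n: "lookup (lookup (A - B) y) k \<noteq> 0"
    then have "y \<noteq> w" using assms by (auto simp: canonical_def lookup_minus)
    moreover have "lookup (lookup A y) k \<noteq> 0 \<or> lookup (lookup B y) k \<noteq> 0"
      using n by (auto simp: lookup_minus)
    ultimately show "k < - int (l y)" using assms by (auto simp: canonical_def)
  qed
  then show ?thesis by simp
qed

text \<open>The element of maximal length in \<open>Z\<close> is removed from the support of \<open>D\<close> by subtracting the part of
  its coefficient of negative degree (relative to \<open>v\<^sup>-\<^sup>l\<^sup>(\<^sup>y\<^sup>)\<close>).\<close>

lemma anti_invariant_split:
  assumes "finite Z" "Z \<subseteq> I" "\<And>x y. y \<in> Z \<Longrightarrow> x \<in> I \<Longrightarrow> le x y \<Longrightarrow> x \<in> Z"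
    and "\<And>y. y \<in> Z \<Longrightarrow> l y \<le> n"
    and "D \<in> V" "bar D = - D" "\<And>y. lookup D y \<noteq> 0 \<Longrightarrow> y \<in> Z"
    and "\<And>y k. lookup (lookup D y) k \<noteq> 0 \<Longrightarrow> - int n \<le> k \<and> even (k + int n)"
  shows "\<exists>E. E \<in> V \<and> E - bar E = D \<and> (\<forall>y. lookup E y \<noteq> 0 \<longrightarrow> y \<in> Z) \<and>
    (\<forall>y k. lookup (lookup E y) k \<noteq> 0 \<longrightarrow> k < - int (l y) \<and> - int n \<le> k \<and> even (k + int n))"
  using assms
proof (induction "card Z" arbitrary: Z D)
  case 0
  then have "lookup D y = 0" for y by auto
  then have "D = 0" by (intro poly_mapping_eqI) simp
  then show ?case by (intro exI[of _ 0]) (simp add: free_module_v_closed bar_0)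
next
  case (Suc c)
  note Z = Suc.prems(1-4) and D = Suc.prems(5-8)
  have "Z \<noteq> {}" using Suc.hyps(2) by auto
  then obtain y where y: "y \<in> Z" "\<And>z. z \<in> Z \<Longrightarrow> l z \<le> l y"
    using finite_has_maximum[of Z l] Z(1) by metis
  have yI: "y \<in> I" using y Z by auto
  \<comment> \<open>Anti-invariance at a longest element is antisymmetry of the coefficient about
    the exponent \<open>- l y\<close>.\<close>
  have d: "lookup (lookup D y) (- k - 2 * int (l y)) = - lookup (lookup D y) k" for k
  proof -
    have "lookup (bar D) y = lbar (lookup D y) * vpow (- 2 * int (l y))"
      using lookup_bar_maximal[OF D(1) yI] y D(3) by blast
    then have "lookup (- lookup D y) k = lookup (lbar (lookup D y) * vpow (- 2 * int (l y))) k"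
      using D(2) by simp
    then show ?thesis by (simp add: lookup_mult_vpow algebra_simps)
  qed
  obtain e where e: "\<And>k. lookup e k = (if k < - int (l y) then lookup (lookup D y) k else 0)"
    using laurent_truncate by meson
  define E0 where "E0 = e *\<^sub>L basis_elt y"
  have E0V: "E0 \<in> V" using yI by (simp add: E0_def free_module_v_closed)
  have barE0: "bar E0 = lbar e *\<^sub>L bar (basis_elt y)"
    using yI by (simp add: E0_def bar_lscale free_module_v_closed)
  have E0_lookup: "lookup E0 x = (if x = y then e else 0)" for x
    by (simp add: E0_def lookup_basis_elt)
  have e_exp: "- int n \<le> k \<and> even (k + int n)" if "lookup e k \<noteq> 0" for k
    using that D(4)[of y k] by (auto simp: e split: if_splits)
  \<comment> \<open>Subtracting \<open>E0 - bar E0\<close>, which is itself anti-invariant because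
    bar is an involution, keeps \<open>D'\<close> anti-invariant.\<close>
  define D' where "D' = D - E0 + bar E0"
  have D'V: "D' \<in> V" using D(1) E0V by (simp add: D'_def free_module_v_closed bar_closed)
  have D'bar: "bar D' = - D'"
    using D(1,2) E0V
    by (simp add: D'_def bar_add bar_diff free_module_v_closed bar_closed bar_bar)
  have D'y: "lookup D' y = 0"
  proof (rule poly_mapping_eqI)
    fix k
    have b: "lookup (bar E0) y = lbar e * vpow (- 2 * int (l y))"
      using yI by (simp add: barE0 bar_basis_diag)
    \<comment> \<open>The middle exponent is its own mirror image, so its integer coefficient equals
      its negative. The lower half is removed by \<open>e\<close> and the upper half by its bar
      conjugate, leaving nothing at \<open>y\<close>.\<close>
    have "lookup (lookup D y) (- int (l y)) = 0" using d[of "- int (l y)"] by simp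
    then show "lookup (lookup D' y) k = lookup (0 :: laurent) k"
      using d[of k]
      by (cases "k = - int (l y)")
        (auto simp: D'_def lookup_add lookup_minus E0_lookup b lookup_mult_vpow e algebra_simps)
  qed
  have D'Z: "x \<in> Z - {y}" if "lookup D' x \<noteq> 0" for x
  proof -
    have "x \<noteq> y" using that D'y by auto
    moreover have "x \<in> I" using that D'V by (simp add: free_module_v_iff)
    moreover have "lookup D x \<noteq> 0 \<or> lookup (bar (basis_elt y)) x \<noteq> 0"
      using that \<open>x \<noteq> y\<close> by (auto simp: D'_def lookup_add lookup_minus E0_lookup barE0)
    ultimately show ?thesis using D(3)[of x] Z(3)[OF y(1), of x] bar_basis_le[OF yI, of x] by auto
  qed
  have D'exp: "- int n \<le> k \<and> even (k + int n)" if D'k: "lookup (lookup D' x) k \<noteq> 0" for x k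
  proof -
    have "lookup (lookup D' x) k = lookup (lookup D x) k - (if x = y then lookup e k else 0)
        + lookup (lbar e * lookup (bar (basis_elt y)) x) k"
      by (simp add: D'_def lookup_add lookup_minus E0_lookup barE0)
    then have "lookup (lookup D x) k \<noteq> 0 \<or> lookup e k \<noteq> 0
        \<or> lookup (lbar e * lookup (bar (basis_elt y)) x) k \<noteq> 0"
      using D'k by (auto split: if_splits)
    then consider "lookup (lookup D x) k \<noteq> 0" | "lookup e k \<noteq> 0"
      | "lookup (lbar e * lookup (bar (basis_elt y)) x) k \<noteq> 0"
      by blast
    then show ?thesis
    proof cases
      case 3
      then obtain i j where ij: "lookup (lbar e) i \<noteq> 0" "lookup (lookup (bar (basis_elt y)) x) j \<noteq> 0"
        "k = i + j" by (rule lookup_mult_nonzero)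
      \<comment> \<open>Here \<open>i > l y\<close> and \<open>j \<ge> - 2 * l y\<close>, so
        \<open>i + j > - l y \<ge> - n\<close>: the negative degree of \<open>e\<close> compensates
        the low exponents of the bar map.\<close>
      have "- i < - int (l y)" using ij(1) e[of "- i"] by (auto split: if_splits)
      moreover have "even (- i + int n)" using ij(1) e_exp[of "- i"] by simp
      moreover have "even j" "- 2 * int (l y) \<le> j" using bar_basis_exponents[OF yI ij(2)] by auto
      moreover have "int (l y) \<le> int n" using Z(4) y(1) by simp
      ultimately show ?thesis using ij(3) by (auto simp: even_add)
    qed (use D(4) e_exp in auto)
  qed
  have "\<exists>E. E \<in> V \<and> E - bar E = D' \<and> (\<forall>x. lookup E x \<noteq> 0 \<longrightarrow> x \<in> Z - {y}) \<and>
    (\<forall>x k. lookup (lookup E x) k \<noteq> 0 \<longrightarrow> k < - int (l x) \<and> - int n \<le> k \<and> even (k + int n))"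
  proof (rule Suc.hyps(1))
    show "c = card (Z - {y})" using Suc.hyps(2) y(1) Z(1) by simp
    \<comment> \<open>Since \<open>y\<close> has maximal length in \<open>Z\<close>, nothing else in
      \<open>Z\<close> lies above it, and the remaining set is still closed downwards.\<close>
    show "x \<in> Z - {y}" if "z \<in> Z - {y}" "x \<in> I" "le x z" for x z
      using that Z(3)[of z x] le_len[of y z] y(2)[of z] by fastforce
  qed (use Z D'V D'bar D'Z D'exp in auto)
  then obtain E' where E': "E' \<in> V" "E' - bar E' = D'" "\<And>x. lookup E' x \<noteq> 0 \<Longrightarrow> x \<in> Z - {y}"
    "\<And>x k. lookup (lookup E' x) k \<noteq> 0 \<Longrightarrow> k < - int (l x) \<and> - int n \<le> k \<and> even (k + int n)"
    by blast
  show ?case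
  proof (intro exI[of _ "E0 + E'"] conjI allI impI)
    show "E0 + E' \<in> V" using E0V E' by (simp add: free_module_v_closed)
    have "E0 + E' - bar (E0 + E') = E0 - bar E0 + (E' - bar E')"
      using E0V E'(1) by (simp add: bar_add)
    then show "E0 + E' - bar (E0 + E') = D" unfolding E'(2) by (simp add: D'_def)
    show "x \<in> Z" if "lookup (E0 + E') x \<noteq> 0" for x
      using that E'(3)[of x] y(1) by (auto simp: lookup_add E0_lookup split: if_splits)
    fix x k assume "lookup (lookup (E0 + E') x) k \<noteq> 0"
    then consider "x = y" "lookup e k \<noteq> 0" | "lookup (lookup E' x) k \<noteq> 0"
      by (fastforce simp: lookup_add E0_lookup split: if_splits)
    then have "k < - int (l x) \<and> - int n \<le> k \<and> even (k + int n)"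
      by cases (use e e_exp E'(4) in \<open>auto split: if_splits\<close>)
    then show "k < - int (l x)" "- int n \<le> k" "even (k + int n)" by auto
  qed
qed

lemma canonical_exists:
  assumes w: "w \<in> I" shows "\<exists>A. canonical w A"
proof -
  define a where "a = vpow (- int (l w)) *\<^sub>L basis_elt w"
  define Z where "Z = {y \<in> I. le y w} - {w}"
  have aV: "a \<in> V" using w by (simp add: a_def free_module_v_closed)
  have bara: "bar a = vpow (int (l w)) *\<^sub>L bar (basis_elt w)"
    using w by (simp add: a_def bar_vpow free_module_v_closed)
  have a_lookup: "lookup a y = (if y = w then vpow (- int (l w)) else 0)" for y
    by (simp add: a_def lookup_basis_elt)
  define D where "D = bar a - a"
  have DV: "D \<in> V" using aV by (simp add: D_def free_module_v_closed bar_closed)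
  \<comment> \<open>The leading coefficient of \<open>bar a\<close> is \<open>v^(l w)\<close> times
    \<open>v^(-2 * l w)\<close>, the same as that of \<open>a\<close>. Thus \<open>D\<close> lives
    strictly below \<open>w\<close>.\<close>
  have Dw: "lookup D w = 0"
    using w by (simp add: D_def lookup_minus a_lookup bara bar_basis_diag vpow_add)
  have DZ: "y \<in> Z" if "lookup D y \<noteq> 0" for y
  proof -
    have "y \<noteq> w" using that Dw by auto
    moreover from this have "lookup (bar (basis_elt w)) y \<noteq> 0"
      using that by (auto simp: D_def lookup_minus a_lookup bara)
    ultimately show ?thesis
      using bar_basis_le[OF w] that DV by (auto simp: Z_def free_module_v_iff)
  qed
  have "\<exists>E. E \<in> V \<and> E - bar E = D \<and> (\<forall>y. lookup E y \<noteq> 0 \<longrightarrow> y \<in> Z) \<and>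
    (\<forall>y k. lookup (lookup E y) k \<noteq> 0 \<longrightarrow> k < - int (l y) \<and> - int (l w) \<le> k \<and> even (k + int (l w)))"
  proof (rule anti_invariant_split)
    show "finite Z" "Z \<subseteq> I" using finite_below[OF w] by (auto simp: Z_def)
    show "x \<in> Z" if "y \<in> Z" "x \<in> I" "le x y" for x y
      using that le_trans[of x y w] le_len[of y w] le_len[of w y] by (auto simp: Z_def)
    show "l y \<le> l w" if "y \<in> Z" for y
      using that le_len[of y w] by (auto simp: Z_def)
    show "bar D = - D" using aV by (simp add: D_def bar_diff bar_closed bar_bar)
    fix y k assume n: "lookup (lookup D y) k \<noteq> 0"
    then have "y \<noteq> w" using Dw by auto
    then have "lookup (lookup (bar (basis_elt w)) y) (k - int (l w)) \<noteq> 0"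
      using n by (simp add: D_def lookup_minus a_lookup bara lookup_vpow_mult)
    then have "even (k - int (l w)) \<and> - 2 * int (l w) \<le> k - int (l w)"
      by (rule bar_basis_exponents[OF w])
    then show "- int (l w) \<le> k \<and> even (k + int (l w))" by auto
  qed (use DV DZ in auto)
  then obtain E where E: "E \<in> V" "E - bar E = D" "\<And>y. lookup E y \<noteq> 0 \<Longrightarrow> y \<in> Z"
    "\<And>y k. lookup (lookup E y) k \<noteq> 0 \<Longrightarrow>
      k < - int (l y) \<and> - int (l w) \<le> k \<and> even (k + int (l w))"
    by blast
  have Ew: "lookup E w = 0" using E(3)[of w] by (auto simp: Z_def)
  have "bar (a + E) = bar a + E - (E - bar E)" using aV E(1) by (simp add: bar_add)
  also have "\<dots> = a + E" unfolding E(2) by (simp add: D_def)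
  finally have "bar (a + E) = a + E" .
  then have "canonical w (a + E)"
    unfolding canonical_def using aV E(1) Ew E(4) E(3) le_refl
    by (auto simp: free_module_v_closed lookup_add a_lookup Z_def split: if_splits)
  then show ?thesis by blast
qed

text \<open>The transition matrix is triangular with units \<open>v^(-l w)\<close> on the diagonal.
  In a linear relation, a longest index sees only its own canonical element; spanning follows by
  induction on length, dividing by the unit.\<close>

lemma canonical_basis:
  assumes A: "\<And>w. w \<in> I \<Longrightarrow> canonical w (A w)"
  shows "is_basis_family I A V"
  unfolding is_basis_family_def
proof (intro conjI)
  have Aw: "lookup (A w) w = vpow (- int (l w))" and Ale: "lookup (A w) y \<noteq> 0 \<Longrightarrow> le y w"
    and AV: "A w \<in> V" if "w \<in> I" for w y
    using A[OF that] by (auto simp: canonical_def)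
  have v: "vpow n \<noteq> 0" for n by (simp add: vpow_def)
  show inj: "inj_on A I"
  proof (rule inj_onI)
    fix x y assume xy: "x \<in> I" "y \<in> I" "A x = A y"
    have "le x y" "le y x" using xy Ale Aw v by metis+
    then show "x = y" using le_len[of x y] le_len[of y x] by auto
  qed
  show "lmod.independent (A ` I)"
  proof
    assume "lmod.dependent (A ` I)"
    then obtain t u where t: "finite t" "t \<subseteq> A ` I" "(\<Sum>a\<in>t. u a *\<^sub>L a) = 0" "\<exists>a\<in>t. u a \<noteq> 0"
      unfolding lmod.dependent_explicit by blast
    define K where "K = {w \<in> I. A w \<in> t \<and> u (A w) \<noteq> 0}"
    have "K \<noteq> {}" using t(2,4) by (auto simp: K_def)
    \<comment> \<open>The relation is indexed by elements of the image of \<open>A\<close>, so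
      injectivity is used to pass to indices in \<open>I\<close>.\<close>
    moreover have "finite K"
    proof (rule finite_imageD)
      show "finite (A ` K)" using t(1) by (rule rev_finite_subset) (auto simp: K_def)
      show "inj_on A K" using inj by (rule inj_on_subset) (auto simp: K_def)
    qed
    ultimately obtain w where w: "w \<in> K" "\<And>z. z \<in> K \<Longrightarrow> l z \<le> l w"
      using finite_has_maximum[of K l] by metis
    have "0 = lookup (\<Sum>a\<in>t. u a *\<^sub>L a) w" unfolding t(3) by simp
    also have "\<dots> = (\<Sum>a\<in>t. u a * lookup a w)" by (simp add: lookup_sum)
    also have "\<dots> = (\<Sum>a\<in>t. if a = A w then u (A w) * vpow (- int (l w)) else 0)"
    proof (rule sum.cong)
      fix a assume a: "a \<in> t"
      then obtain z where z: "z \<in> I" "a = A z" using t(2) by auto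
      have "u a * lookup a w = 0" if "a \<noteq> A w"
      proof (rule ccontr)
        assume n: "u a * lookup a w \<noteq> 0"
        then have "z \<in> K" using a z by (auto simp: K_def)
        moreover have "le w z" using n z Ale by auto
        ultimately show False using w(2)[of z] le_len[of w z] that z by auto
      qed
      then show "u a * lookup a w = (if a = A w then u (A w) * vpow (- int (l w)) else 0)"
        using w(1) Aw by (auto simp: K_def)
    qed simp
    also have "\<dots> = u (A w) * vpow (- int (l w))" using w(1) t(1) by (simp add: K_def)
    finally show False using w(1) v by (simp add: K_def)
  qed
  have basis: "basis_elt w \<in> lmod.span (A ` I)" if "w \<in> I" for w
    using that
  proof (induction "l w" arbitrary: w rule: less_induct)
    case less
    let ?K = "{y \<in> I. le y w}"
    have f: "finite ?K" using finite_below less.prems by blast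
    have "A w = (\<Sum>y\<in>?K. lookup (A w) y *\<^sub>L basis_elt y)"
      using f Ale[OF less.prems] AV[OF less.prems]
      by (intro basis_expansion) (auto simp: free_module_v_iff)
    also have "\<dots> = vpow (- int (l w)) *\<^sub>L basis_elt w
        + (\<Sum>y\<in>?K - {w}. lookup (A w) y *\<^sub>L basis_elt y)"
      using f less.prems by (subst sum.remove[of _ w]) (auto simp: le_refl Aw)
    finally have e: "vpow (- int (l w)) *\<^sub>L basis_elt w =
        A w - (\<Sum>y\<in>?K - {w}. lookup (A w) y *\<^sub>L basis_elt y)"
      unfolding eq_diff_eq by (rule sym)
    have "vpow (- int (l w)) *\<^sub>L basis_elt w \<in> lmod.span (A ` I)"
      unfolding e
    proof (intro lmod.span_diff lmod.span_sum lmod.span_scale)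
      show "A w \<in> lmod.span (A ` I)" using less.prems by (auto intro: lmod.span_base)
      show "basis_elt y \<in> lmod.span (A ` I)" if "y \<in> ?K - {w}" for y
        using that less.hyps[of y] le_len[of y w] by auto
    qed
    then have "vpow (int (l w)) *\<^sub>L vpow (- int (l w)) *\<^sub>L basis_elt w \<in> lmod.span (A ` I)"
      by (rule lmod.span_scale)
    then show ?case by (simp add: vpow_add)
  qed
  show "lmod.span (A ` I) = V"
  proof
    have "lmod.subspace V" by (auto simp: lmod.subspace_def free_module_v_closed)
    then show "lmod.span (A ` I) \<subseteq> V" using AV by (intro lmod.span_minimal) auto
    show "V \<subseteq> lmod.span (A ` I)"
    proof
      fix m assume m: "m \<in> V"
      have "m = (\<Sum>y\<in>keys m. lookup m y *\<^sub>L basis_elt y)"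
        by (rule basis_expansion) (auto simp: in_keys_iff)
      also have "\<dots> \<in> lmod.span (A ` I)"
        using m by (intro lmod.span_sum lmod.span_scale basis) (auto simp: free_module_v_iff in_keys_iff)
      finally show "m \<in> lmod.span (A ` I)" .
    qed
  qed
qed

end

section \<open>Involutions and the bar map\<close>

lemma lookup_one_plus_u_mult:
  "lookup ((upow 1 + 1) * f) k = lookup f (k - 2) + lookup f k"
  by (simp add: upow_def distrib_right lookup_add lookup_vpow_mult)

text \<open>At the lowest exponent of \<open>f\<close> the term shifted by \<open>u\<close>
  contributes nothing, so the product has a nonzero coefficient there too.\<close>

lemma one_plus_u_exponents:
  assumes "\<And>k. lookup ((upow 1 + 1) * f) k \<noteq> 0 \<Longrightarrow> N \<le> k" and "lookup f k \<noteq> 0"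
  shows "N \<le> k"
proof -
  define j where "j = Min (keys f)"
  have k: "k \<in> keys f" using assms(2) by (simp add: in_keys_iff)
  then have "j \<in> keys f" unfolding j_def by (intro Min_in) auto
  moreover have "lookup f (j - 2) = 0"
  proof (rule ccontr)
    assume "lookup f (j - 2) \<noteq> 0"
    then have "j \<le> j - 2"
      by (subst j_def, intro Min_le) (simp_all add: in_keys_iff)
    then show False by simp
  qed
  ultimately have "N \<le> j" using assms(1)[of j] by (simp add: lookup_one_plus_u_mult in_keys_iff)
  also have "j \<le> k" using k by (simp add: j_def)
  finally show ?thesis .
qed

lemma one_plus_u_nonzero: "upow 1 + 1 \<noteq> (0 :: laurent)"
proof
  assume "upow 1 + 1 = (0 :: laurent)"
  then have "lookup (upow 1 + 1) 0 = (0 :: int)" by simp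
  then show False by (simp add: upow_def lookup_add lookup_vpow lookup_one)
qed

section \<open>Twisting involutions by simple reflections\<close>

text \<open>The index of the second basis element in the formula for \<open>T_s + 1\<close>,
  uniformly in all four cases. It is also the move by which involutions are built from the
  identity.\<close>

definition twist :: "('a \<Rightarrow> 'a) \<Rightarrow> ('a \<Rightarrow> 'a) \<Rightarrow> 'a \<Rightarrow> 'a" where
  "twist s w = (if s \<circ> w = w \<circ> s then s \<circ> w else s \<circ> w \<circ> s)"

lemma twist_commute: "s \<circ> w = w \<circ> s \<Longrightarrow> twist s w = s \<circ> w"
  unfolding twist_def by (rule if_P)

lemma twist_noncommute: "s \<circ> w \<noteq> w \<circ> s \<Longrightarrow> twist s w = s \<circ> w \<circ> s"
  unfolding twist_def by (rule if_not_P)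

text \<open>Twisting does not change whether \<open>s\<close> commutes with the element, so the
  second twist falls into the same case and undoes the first.\<close>

lemma twist_twist:
  assumes s: "s \<circ> s = id" shows "twist s (twist s w) = w"
proof (cases "s \<circ> w = w \<circ> s")
  case True
  have 1: "s \<circ> (s \<circ> w) = w" by (simp only: o_assoc s id_comp)
  have "s \<circ> w \<circ> s = s \<circ> (s \<circ> w)" by (simp only: comp_assoc True[symmetric])
  then have "twist s (s \<circ> w) = w" using 1 twist_commute[of s "s \<circ> w"] by argo
  then show ?thesis unfolding twist_commute[OF True] .
next
  case False
  have 1: "s \<circ> (s \<circ> w \<circ> s) = w \<circ> s" by (simp only: o_assoc s id_comp)
  have 2: "s \<circ> w \<circ> s \<circ> s = s \<circ> w" by (simp only: comp_assoc s comp_id)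
  have 3: "w \<circ> s \<circ> s = w" by (simp only: comp_assoc s comp_id)
  have "s \<circ> (s \<circ> w \<circ> s) \<noteq> s \<circ> w \<circ> s \<circ> s" unfolding 1 2 using False by (rule not_sym)
  then have "twist s (s \<circ> w \<circ> s) = w" using twist_noncommute 1 3 by metis
  then show ?thesis unfolding twist_noncommute[OF False] .
qed

context based_root_system
begin

abbreviation I where "I \<equiv> involutions W"

lemma involution_weyl: "w \<in> I \<Longrightarrow> w \<in> W"
  and involution_square: "w \<in> I \<Longrightarrow> w \<circ> w = id"
  by (auto simp: involutions_def)

lemma inv_involution: "w \<in> I \<Longrightarrow> inv w = w"
  by (rule inv_unique_comp) (rule involution_square, assumption)+

lemma inv_simple: "s \<in> S \<Longrightarrow> inv s = s"
  by (rule inv_unique_comp) (rule simple_involution, assumption)+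

lemma simple_in_weyl: "s \<in> S \<Longrightarrow> s \<in> W"
  using simple_weyl by blast

lemma inv_comp: "x \<in> W \<Longrightarrow> y \<in> W \<Longrightarrow> inv (x \<circ> y) = inv y \<circ> inv x"
  by (rule o_inv_distrib) (rule weyl_bij, assumption)+

lemma twist_involution:
  assumes w: "w \<in> I" and s: "s \<in> S" shows "twist s w \<in> I"
proof -
  note ss = simple_involution[OF s] and ww = involution_square[OF w]
  note sW = simple_in_weyl[OF s] and wW = involution_weyl[OF w]
  show ?thesis
  proof (cases "s \<circ> w = w \<circ> s")
    case True
    have "s \<circ> w \<circ> (s \<circ> w) = s \<circ> w \<circ> (w \<circ> s)" by (simp only: True)
    also have "\<dots> = s \<circ> (w \<circ> w) \<circ> s" by (simp only: comp_assoc)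
    also have "\<dots> = id" by (simp only: ww comp_id ss)
    finally show ?thesis
      using weyl_comp[OF sW wW] unfolding twist_commute[OF True] involutions_def by blast
  next
    case False
    have "s \<circ> w \<circ> s \<circ> (s \<circ> w \<circ> s) = s \<circ> (w \<circ> (s \<circ> s) \<circ> w) \<circ> s" by (simp only: comp_assoc)
    also have "\<dots> = id" by (simp only: ww comp_id ss)
    finally show ?thesis
      using weyl_comp[OF weyl_comp[OF sW wW] sW]
      unfolding twist_noncommute[OF False] involutions_def by blast
  qed
qed

lemma len_involution_simple:
  assumes "w \<in> I" "s \<in> S" shows "len (w \<circ> s) = len (s \<circ> w)"
  using len_inv[OF weyl_comp[OF simple_in_weyl[OF assms(2)] involution_weyl[OF assms(1)]]]
    inv_comp[OF simple_in_weyl[OF assms(2)] involution_weyl[OF assms(1)]]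
  by (simp add: inv_involution inv_simple assms)

text \<open>Turns the Bruhat conditions in \<open>T_plus_one_basis\<close> into one comparison of
  lengths. For an involution \<open>w\<close>, the element \<open>w \<circ> s\<close> is the inverse
  of \<open>s \<circ> w\<close>, so both sides behave alike.\<close>

lemma bruhat_less_iff:
  assumes w: "w \<in> I" and s: "s \<in> S"
  shows "bruhat_less W S w (s \<circ> w) \<longleftrightarrow> len w < len (s \<circ> w)"
    and "bruhat_less W S w (w \<circ> s) \<longleftrightarrow> len w < len (s \<circ> w)"
proof -
  note sW = simple_in_weyl[OF s] and wW = involution_weyl[OF w]
  have le: "le w (s \<circ> w)" if "len w < len (s \<circ> w)" using le_simple wW s that by blast
  then show "bruhat_less W S w (s \<circ> w) \<longleftrightarrow> len w < len (s \<circ> w)"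
    using le_len[of w "s \<circ> w"] by (auto simp: bruhat_less_def)
  have "le w (w \<circ> s)" if "len w < len (s \<circ> w)"
    using le_inv[OF le[OF that] wW] by (simp add: inv_comp[OF sW wW] inv_involution w inv_simple s)
  then show "bruhat_less W S w (w \<circ> s) \<longleftrightarrow> len w < len (s \<circ> w)"
    using le_len[of w "w \<circ> s"] len_involution_simple[OF w s] by (auto simp: bruhat_less_def)
qed

text \<open>If \<open>s w s\<close> is not two steps away from \<open>w\<close>, then \<open>w\<close> maps the root of \<open>s\<close> to \<open>\<plusminus>\<close> itself, so \<open>s\<close> and
  \<open>w\<close> commute.\<close>

lemma len_conjugate:
  assumes w: "w \<in> I" and s: "s \<in> S" and nc: "s \<circ> w \<noteq> w \<circ> s"
  shows "len w < len (s \<circ> w) \<Longrightarrow> len (s \<circ> w \<circ> s) = len w + 2"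
    and "len (s \<circ> w) < len w \<Longrightarrow> len w = len (s \<circ> w \<circ> s) + 2"
proof -
  note sW = simple_in_weyl[OF s] and wW = involution_weyl[OF w]
  obtain \<alpha> where a: "\<alpha> \<in> \<Delta>" "s = root_reflection \<alpha>"
    using s by (auto simp: simple_reflections_def)
  have wa: "w \<alpha> \<in> \<Phi>" using weyl_root[OF wW] a base_roots by blast
  have ne: "root_reflection (w \<alpha>) \<noteq> s"
    using nc orthogonal_comp_root_reflection[OF weyl_orthogonal[OF wW], of \<alpha>] a by auto
  then have ne1: "w \<alpha> \<noteq> \<alpha>" and ne2: "- w \<alpha> \<noteq> \<alpha>"
    using a(2) root_reflection_minus by metis+
  have xW: "w \<circ> s \<in> W" using weyl_comp wW sW by blast
  have x: "inv (w \<circ> s) \<alpha> = s (w \<alpha>)"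
    by (simp add: inv_comp[OF wW sW] inv_involution w inv_simple s)
  have lx: "len (s \<circ> w \<circ> s) < len (w \<circ> s) \<longleftrightarrow> pos (- s (w \<alpha>))"
    using len_reflection(1)[OF xW pos_base[OF a(1)]] a(2) x by (simp add: comp_assoc)
  have lw: "len (s \<circ> w) < len w \<longleftrightarrow> pos (- w \<alpha>)"
    using len_reflection(1)[OF wW pos_base[OF a(1)]] a(2) by (simp add: inv_involution w)
  have step_x: "len (s \<circ> w \<circ> s) = Suc (len (w \<circ> s)) \<or> len (w \<circ> s) = Suc (len (s \<circ> w \<circ> s))"
    using len_simple[OF xW s] by (simp add: comp_assoc)
  have step_w: "len (s \<circ> w) = Suc (len w) \<or> len w = Suc (len (s \<circ> w))"
    by (rule len_simple[OF wW s])
  note lws = len_involution_simple[OF w s]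
  {
    assume up: "len w < len (s \<circ> w)"
    then have "pos (w \<alpha>)" using lw pos_or_neg[OF wa] by auto
    then have "pos (s (w \<alpha>))" using simple_reflection_pos[OF a(1)] ne1 a(2) by blast
    then have "\<not> len (s \<circ> w \<circ> s) < len (w \<circ> s)" using lx not_pos_and_neg by blast
    then show "len (s \<circ> w \<circ> s) = len w + 2" using step_x step_w up lws by auto
  next
    assume down: "len (s \<circ> w) < len w"
    then have "pos (- w \<alpha>)" using lw by blast
    then have "pos (s (- w \<alpha>))" using simple_reflection_pos[OF a(1)] ne2 a(2) by blast
    then have "len (s \<circ> w \<circ> s) < len (w \<circ> s)" using lx weyl_minus[OF sW] by simp
    then show "len w = len (s \<circ> w \<circ> s) + 2" using step_x step_w down lws by auto
  }
qed

lemma len_twist: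
  assumes w: "w \<in> I" and s: "s \<in> S" and up: "len w < len (s \<circ> w)"
  shows "len (twist s w) = len w + (if s \<circ> w = w \<circ> s then 1 else 2)"
proof (cases "s \<circ> w = w \<circ> s")
  case True
  then show ?thesis using len_simple[OF involution_weyl[OF w] s] up by (simp add: twist_def)
next
  case False
  then show ?thesis using len_conjugate(1)[OF w s False up] by (simp add: twist_def)
qed

text \<open>Monotonicity of an upward twist, which controls the support of the bar map. Since
  \<open>s\<close> may commute with only one of \<open>x\<close> and \<open>w\<close>, both
  \<open>s \<circ> x\<close> and \<open>s \<circ> x \<circ> s\<close> are bounded, by lifting first
  on the left and then on the right.\<close>

lemma twist_le:
  assumes xw: "le x w" and x: "x \<in> W" and w: "w \<in> I" and s: "s \<in> S" and up: "len w < len (s \<circ> w)"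
  shows "le w (twist s w)" and "le (twist s x) (twist s w)"
proof -
  note sW = simple_in_weyl[OF s] and wW = involution_weyl[OF w]
  have wsw: "le w (s \<circ> w)" by (rule le_simple[OF wW s up])
  \<comment> \<open>If \<open>s\<close> and \<open>w\<close> commute,
    \<open>s \<circ> w \<circ> s\<close> is just \<open>w\<close>. Otherwise
    \<open>w \<circ> s\<close> lies below \<open>s \<circ> w \<circ> s\<close>, and inversion gives
    the same for \<open>s \<circ> w\<close>.\<close>
  have swsz: "le (s \<circ> w) (twist s w) \<and> le (s \<circ> w \<circ> s) (twist s w)"
  proof (cases "s \<circ> w = w \<circ> s")
    case True
    have "s \<circ> w \<circ> s = w" unfolding True by (simp only: comp_assoc simple_involution[OF s] comp_id)
    then show ?thesis using True wsw by (simp add: twist_def)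
  next
    case False
    have wsW: "w \<circ> s \<in> W" using weyl_comp wW sW by blast
    have "len (w \<circ> s) < len (s \<circ> (w \<circ> s))"
      using len_conjugate(1)[OF w s False up] len_involution_simple[OF w s]
        len_simple[OF wW s] up by (simp add: comp_assoc)
    then have "le (w \<circ> s) (s \<circ> (w \<circ> s))" by (rule le_simple[OF wsW s])
    then have "le (inv (w \<circ> s)) (inv (s \<circ> (w \<circ> s)))" using le_inv wsW by blast
    then have "le (s \<circ> w) (s \<circ> w \<circ> s)"
      by (simp only: inv_comp[OF sW wsW] inv_comp[OF wW sW] inv_involution[OF w] inv_simple[OF s])
    then show ?thesis using False by (simp add: twist_def)
  qed
  then show "le w (twist s w)" using wsw le_trans by blast
  have sx: "le (s \<circ> x) (s \<circ> w)" using le_lift[OF xw x s] wsw le_trans by blast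
  have sxs: "le (s \<circ> x \<circ> s) (s \<circ> w) \<or> le (s \<circ> x \<circ> s) (s \<circ> w \<circ> s)"
    by (rule le_lift_right[OF sx weyl_comp[OF sW x] weyl_comp[OF sW wW] s])
  have "le (s \<circ> x) (twist s w)" using sx swsz le_trans by blast
  moreover have "le (s \<circ> x \<circ> s) (twist s w)" using sxs swsz le_trans by blast
  ultimately show "le (twist s x) (twist s w)"
    by (cases "s \<circ> x = x \<circ> s") (simp_all only: twist_commute twist_noncommute not_False_eq_True)
qed

lemma descent:
  assumes "w \<in> W" "w \<noteq> id"
  obtains s where "s \<in> S" "len (s \<circ> w) < len w"
proof -
  obtain ss where ss: "set ss \<subseteq> S" "length ss = len w" "w = wd ss" using assms(1) by (rule reduced_word)
  show ?thesis
  proof (cases ss)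
    case Nil
    then show ?thesis using ss assms by simp
  next
    case (Cons s ts)
    then have s: "s \<in> S" "set ts \<subseteq> S" using ss by auto
    have "s \<circ> w = wd ts"
      unfolding ss(3) Cons wd_Cons by (simp only: o_assoc simple_involution[OF s(1)] id_comp)
    then have "len (s \<circ> w) \<le> length ts" using word_length_le[OF s(2)] by simp
    then show ?thesis using that s ss Cons by simp
  qed
qed

text \<open>A left descent \<open>s\<close> of a nontrivial involution makes
  \<open>twist s w\<close> shorter and is an ascent of it, so twisting back exhibits
  \<open>w\<close> as the result of an upward move.\<close>

lemma involution_induct [consumes 1, case_names id twist]:
  assumes "w \<in> I" and "P id"
    and step: "\<And>w s. w \<in> I \<Longrightarrow> s \<in> S \<Longrightarrow> len w < len (s \<circ> w) \<Longrightarrow> P w \<Longrightarrow> P (twist s w)"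
  shows "P w"
  using assms(1)
proof (induction "len w" arbitrary: w rule: less_induct)
  case less
  note w = less.prems
  note wW = involution_weyl[OF w]
  show ?case
  proof (cases "w = id")
    case False
    then obtain s where s: "s \<in> S" "len (s \<circ> w) < len w" using descent[OF wW] by metis
    note ss = simple_involution[OF s(1)]
    have "len (twist s w) < len w \<and> len (twist s w) < len (s \<circ> twist s w)"
    proof (cases "s \<circ> w = w \<circ> s")
      case True
      have "s \<circ> (s \<circ> w) = w" by (simp only: o_assoc ss id_comp)
      then show ?thesis using True s by (simp add: twist_def)
    next
      case nc: False
      have "s \<circ> (s \<circ> w \<circ> s) = w \<circ> s" by (simp only: o_assoc ss id_comp)
      then show ?thesis
        using nc len_conjugate(2)[OF w s(1) nc s(2)] len_involution_simple[OF w s(1)]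
          len_simple[OF wW s(1)] s(2)
        by (simp add: twist_def)
    qed
    then have "P (twist s (twist s w))"
      using less.hyps[of "twist s w"] twist_involution[OF w s(1)] s(1) by (intro step[of "twist s w" s]) simp_all
    then show ?thesis using twist_twist[OF ss] by simp
  qed (use assms(2) in simp)
qed

section \<open>The operators \<open>T_s + 1\<close>\<close>

definition T_coeff :: "('a \<Rightarrow> 'a) \<Rightarrow> ('a \<Rightarrow> 'a) \<Rightarrow> laurent" where
  "T_coeff s w =
     (if s \<circ> w = w \<circ> s then (if bruhat_less W S w (s \<circ> w) then upow 1 + 1 else upow 2 - upow 1)
      else (if bruhat_less W S w (w \<circ> s) then 1 else upow 2))"

lemma T_plus_one_basis_eq:
  "T_plus_one_basis W S s w = T_coeff s w *\<^sub>L (basis_elt w + basis_elt (twist s w))"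
  by (simp add: T_plus_one_basis_def T_coeff_def twist_def)

lemma T_coeff_exponents: "lookup (T_coeff s w) k \<noteq> 0 \<Longrightarrow> 0 \<le> k"
  by (auto simp: T_coeff_def upow_def lookup_add lookup_minus lookup_vpow lookup_one split: if_splits)

lemma T_coeff_up:
  assumes "w \<in> I" "s \<in> S" "len w < len (s \<circ> w)"
  shows "T_coeff s w = (if s \<circ> w = w \<circ> s then upow 1 + 1 else 1)"
  using bruhat_less_iff[OF assms(1,2)] assms(3) by (simp add: T_coeff_def)

definition T_plus_one :: "('a \<Rightarrow> 'a) \<Rightarrow> (('a \<Rightarrow> 'a) \<Rightarrow>\<^sub>0 laurent) \<Rightarrow> (('a \<Rightarrow> 'a) \<Rightarrow>\<^sub>0 laurent)" where
  "T_plus_one s m = hecke_T W S s m + m"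

lemma T_plus_one_eq: "T_plus_one s m = (\<Sum>w\<in>keys m. lookup m w *\<^sub>L T_plus_one_basis W S s w)"
proof -
  have "hecke_T W S s m = (\<Sum>w\<in>keys m. lookup m w *\<^sub>L T_plus_one_basis W S s w)
      - (\<Sum>w\<in>keys m. lookup m w *\<^sub>L basis_elt w)"
    by (simp add: hecke_T_def lmod.scale_right_diff_distrib sum_subtractf)
  also have "(\<Sum>w\<in>keys m. lookup m w *\<^sub>L basis_elt w) = m"
    by (rule basis_expansion[symmetric]) (auto simp: in_keys_iff)
  finally show ?thesis unfolding T_plus_one_def by simp
qed

lemma T_plus_one_basis_elt: "T_plus_one s (basis_elt w) = T_plus_one_basis W S s w"
  by (simp add: T_plus_one_eq basis_elt_def)

lemma lookup_T_plus_one: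
  "lookup (T_plus_one s m) y = (\<Sum>w\<in>keys m. lookup m w * (T_coeff s w *
     (lookup (basis_elt w) y + lookup (basis_elt (twist s w)) y)))"
  by (simp add: T_plus_one_eq T_plus_one_basis_eq lookup_sum lookup_add mult.assoc)

lemma T_plus_one_support:
  assumes "lookup (T_plus_one s m) y \<noteq> 0"
  obtains x where "lookup m x \<noteq> 0" "y = x \<or> y = twist s x"
proof -
  obtain x where "x \<in> keys m" "lookup m x * (T_coeff s x *
     (lookup (basis_elt x) y + lookup (basis_elt (twist s x)) y)) \<noteq> 0"
    using assms unfolding lookup_T_plus_one by (meson sum.not_neutral_contains_not_neutral)
  then show ?thesis using that[of x] by (auto simp: lookup_basis_elt in_keys_iff split: if_splits)
qed

text \<open>Every \<open>T_coeff\<close> is a polynomial in \<open>u\<close>, so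
  \<open>T_s + 1\<close> preserves lower bounds on exponents.\<close>

lemma T_plus_one_exponents:
  assumes "\<And>x k. lookup (lookup m x) k \<noteq> 0 \<Longrightarrow> N \<le> k"
    and "lookup (lookup (T_plus_one s m) y) k \<noteq> 0"
  shows "N \<le> k"
proof -
  obtain x where "lookup (lookup m x * (T_coeff s x *
     (lookup (basis_elt x) y + lookup (basis_elt (twist s x)) y))) k \<noteq> 0"
    using assms(2) unfolding lookup_T_plus_one lookup_sum
    by (meson sum.not_neutral_contains_not_neutral)
  then obtain i j where ij: "lookup (lookup m x) i \<noteq> 0" "lookup (T_coeff s x *
     (lookup (basis_elt x) y + lookup (basis_elt (twist s x)) y)) j \<noteq> 0" "k = i + j"
    by (rule lookup_mult_nonzero)
  from ij(2) obtain a b where ab: "lookup (T_coeff s x) a \<noteq> 0"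
    "lookup (lookup (basis_elt x) y + lookup (basis_elt (twist s x)) y :: laurent) b \<noteq> 0" "j = a + b"
    by (rule lookup_mult_nonzero)
  have "b = 0" using ab(2) by (auto simp: lookup_add lookup_basis_elt lookup_one split: if_splits)
  then show ?thesis using ij ab assms(1)[OF ij(1)] T_coeff_exponents[OF ab(1)] by simp
qed

lemma T_plus_one_closed:
  assumes "m \<in> free_module_v I" "s \<in> S" shows "T_plus_one s m \<in> free_module_v I"
  unfolding free_module_v_iff
proof (intro allI impI)
  fix y assume "lookup (T_plus_one s m) y \<noteq> 0"
  then obtain x where "lookup m x \<noteq> 0" "y = x \<or> y = twist s x" by (rule T_plus_one_support)
  then show "y \<in> I" using assms twist_involution by (auto simp: free_module_v_iff)
qed

end

section \<open>Triangularity of the bar map on involutions\<close>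

locale weyl_bar = based_root_system \<Phi> \<Delta> for \<Phi> \<Delta> :: "'a::euclidean_space set" +
  fixes bar :: "(('a \<Rightarrow> 'a) \<Rightarrow>\<^sub>0 laurent) \<Rightarrow> (('a \<Rightarrow> 'a) \<Rightarrow>\<^sub>0 laurent)"
  assumes is_bar: "is_bar W S bar"
begin

sublocale semilinear_bar I bar
  using is_bar by unfold_locales (auto simp: is_bar_def Let_def)

lemma bar_free_module_u: "m \<in> free_module_u I \<Longrightarrow> bar m \<in> free_module_u I"
  and bar_id: "bar (basis_elt id) = basis_elt id"
  and bar_T: "m \<in> free_module_u I \<Longrightarrow> s \<in> S \<Longrightarrow>
    bar (T_plus_one s m) = upow (- 2) *\<^sub>L T_plus_one s (bar m)"
  using is_bar by (auto simp: is_bar_def is_bar_u_def Let_def T_plus_one_def)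

lemma basis_free_module_u: "w \<in> I \<Longrightarrow> basis_elt w \<in> free_module_u I"
  by (auto simp: free_module_u_def free_module_v_closed laurent_u_def lookup_basis_elt)

text \<open>Evenness comes from bar preserving the module over \<int>[u,u^-1], which contains the
  basis elements.\<close>

lemma bar_basis_even: "w \<in> I \<Longrightarrow> lookup (lookup (bar (basis_elt w)) y) k \<noteq> 0 \<Longrightarrow> even k"
  using bar_free_module_u[OF basis_free_module_u, of w]
  by (auto simp: free_module_u_def laurent_u_def in_keys_iff)

text \<open>With \<open>z = twist s w\<close> longer than \<open>w\<close>, \<open>(T\<^sub>s + 1) a\<^sub>w = c (a\<^sub>w + a\<^sub>z)\<close> where \<open>c\<close> is \<open>1\<close> or \<open>u + 1\<close>, and in both
  cases the bar conjugate of \<open>c\<close> is \<open>u\<^sup>l\<^sup>(\<^sup>z\<^sup>)\<^sup>-\<^sup>l\<^sup>(\<^sup>w\<^sup>)\<^sup>-\<^sup>2 c\<close>.\<close>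

lemma bar_twist:
  assumes w: "w \<in> I" and s: "s \<in> S" and up: "len w < len (s \<circ> w)"
  shows "T_coeff s w *\<^sub>L (bar (basis_elt w) + bar (basis_elt (twist s w)))
    = vpow (2 * int (len w) - 2 * int (len (twist s w))) *\<^sub>L T_plus_one s (bar (basis_elt w))"
proof -
  let ?c = "T_coeff s w" and ?N = "2 * int (len (twist s w)) - 2 * int (len w)"
  have V: "basis_elt w \<in> V" "basis_elt (twist s w) \<in> V"
    using w twist_involution[OF w s] by (auto simp: free_module_v_closed)
  have "upow (- 2) *\<^sub>L T_plus_one s (bar (basis_elt w)) = bar (T_plus_one s (basis_elt w))"
    using bar_T[OF basis_free_module_u[OF w] s] by simp
  also have "\<dots> = lbar ?c *\<^sub>L (bar (basis_elt w) + bar (basis_elt (twist s w)))"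
    using V by (simp add: T_plus_one_basis_elt T_plus_one_basis_eq bar_lscale bar_add
        free_module_v_closed)
  finally have e: "upow (- 2) *\<^sub>L T_plus_one s (bar (basis_elt w))
      = lbar ?c *\<^sub>L (bar (basis_elt w) + bar (basis_elt (twist s w)))" .
  have "lookup ?c k = lookup (vpow (4 - ?N) * lbar ?c) k" for k
    unfolding T_coeff_up[OF assms] len_twist[OF assms]
    by (auto simp: lookup_vpow_mult lookup_add upow_def lookup_vpow lookup_one)
  then have c: "?c = vpow (4 - ?N) * lbar ?c" by (rule poly_mapping_eqI)
  have "?c *\<^sub>L (bar (basis_elt w) + bar (basis_elt (twist s w)))
      = vpow (4 - ?N) *\<^sub>L lbar ?c *\<^sub>L (bar (basis_elt w) + bar (basis_elt (twist s w)))"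
    using c by (metis lmod.scale_scale)
  also have "\<dots> = vpow (4 - ?N) *\<^sub>L upow (- 2) *\<^sub>L T_plus_one s (bar (basis_elt w))"
    unfolding e ..
  also have "\<dots> = vpow (- ?N) *\<^sub>L T_plus_one s (bar (basis_elt w))"
    unfolding lmod.scale_scale upow_def vpow_add by (simp add: algebra_simps)
  finally show ?thesis by (simp add: algebra_simps)
qed

text \<open>For an upward move the coefficient is \<open>1\<close> or \<open>u + 1\<close>: nonzero
  in an integral domain, and with constant term \<open>1\<close>.\<close>

lemma T_coeff_up_cancel:
  assumes "w \<in> I" "s \<in> S" "len w < len (s \<circ> w)"
  shows "T_coeff s w * p = T_coeff s w * q \<longleftrightarrow> p = q"
    and "(\<And>k. lookup (T_coeff s w * p) k \<noteq> 0 \<Longrightarrow> N \<le> k) \<Longrightarrow> lookup p j \<noteq> 0 \<Longrightarrow> N \<le> j"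
proof -
  show "T_coeff s w * p = T_coeff s w * q \<longleftrightarrow> p = q"
    unfolding T_coeff_up[OF assms] using one_plus_u_nonzero by auto
  show "N \<le> j" if "\<And>k. lookup (T_coeff s w * p) k \<noteq> 0 \<Longrightarrow> N \<le> k" "lookup p j \<noteq> 0"
  proof (cases "s \<circ> w = w \<circ> s")
    case True
    then show ?thesis
      using that one_plus_u_exponents[of p N j] unfolding T_coeff_up[OF assms] by presburger
  next
    case False
    then show ?thesis using that(1)[of j] that(2) unfolding T_coeff_up[OF assms] by simp
  qed
qed

lemma bar_basis:
  assumes "w \<in> I"
  shows "bar (bar (basis_elt w)) = basis_elt w \<and>
    lookup (bar (basis_elt w)) w = vpow (- 2 * int (len w)) \<and>
    (\<forall>y. lookup (bar (basis_elt w)) y \<noteq> 0 \<longrightarrow> le y w) \<and>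
    (\<forall>y k. lookup (lookup (bar (basis_elt w)) y) k \<noteq> 0 \<longrightarrow> - 2 * int (len w) \<le> k)"
  using assms
proof (induction rule: involution_induct)
  case id
  define e where "e = (id :: 'a \<Rightarrow> 'a)"
  have "len e = 0" using word_length_le[of "[]" S] unfolding e_def by simp
  then show ?case
    using bar_id unfolding e_def[symmetric] by (auto simp: lookup_basis_elt lookup_one split: if_splits)
next
  case (twist w s)
  note w = twist.hyps(1) and s = twist.hyps(2) and up = twist.hyps(3)
  define z where "z = twist s w"
  define B where "B = bar (basis_elt w)"
  define C where "C = bar (basis_elt z)"
  let ?c = "T_coeff s w"
  have B: "bar B = basis_elt w" "lookup B w = vpow (- 2 * int (len w))"
    "\<And>y. lookup B y \<noteq> 0 \<Longrightarrow> le y w"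
    "\<And>y k. lookup (lookup B y) k \<noteq> 0 \<Longrightarrow> - 2 * int (len w) \<le> k"
    using twist.IH by (auto simp: B_def)
  have zI: "z \<in> I" unfolding z_def by (rule twist_involution[OF w s])
  have lz: "len w < len z" unfolding z_def len_twist[OF w s up] by simp
  have BV: "B \<in> V" and CV: "C \<in> V"
    using w zI by (auto simp: B_def C_def free_module_v_closed bar_closed)
  have BI: "x \<in> I" if "lookup B x \<noteq> 0" for x using BV that by (simp add: free_module_v_iff)
  have wz: "le w z" unfolding z_def using twist_le(1)[OF le_refl _ w s up] involution_weyl[OF w] .
  have Bz: "lookup B z = 0" using B(3)[of z] le_len[of z w] lz by auto
  \<comment> \<open>This relation determines \<open>C\<close> from \<open>B\<close>; each claim
    about \<open>C\<close> follows by cancelling \<open>?c\<close>.\<close>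
  have eq: "?c *\<^sub>L (B + C) = vpow (2 * int (len w) - 2 * int (len z)) *\<^sub>L T_plus_one s B"
    using bar_twist[OF w s up] by (simp add: B_def C_def z_def)
  have eqy: "?c * (lookup B y + lookup C y)
      = vpow (2 * int (len w) - 2 * int (len z)) * lookup (T_plus_one s B) y" for y
    using arg_cong[OF eq, of "\<lambda>m. lookup m y"] by (simp add: lookup_add)
  have Tle: "le y z" if Ty: "lookup (T_plus_one s B) y \<noteq> 0" for y
  proof -
    obtain x where x: "lookup B x \<noteq> 0" "y = x \<or> y = twist s x" using Ty by (rule T_plus_one_support)
    have "le x w" "x \<in> W" using B(3) BI x(1) involution_weyl by blast+
    then show ?thesis using x(2) twist_le(2)[OF _ _ w s up, of x] wz le_trans z_def by blast
  qed
  \<comment> \<open>The longer \<open>z\<close> is not in the support of \<open>B\<close>, and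
    twisting by \<open>s\<close> is injective, so only the term of \<open>B\<close> at
    \<open>w\<close> reaches \<open>z\<close>.\<close>
  have Tz: "lookup (T_plus_one s B) z = vpow (- 2 * int (len w)) * ?c"
  proof -
    have "lookup (T_plus_one s B) z = (\<Sum>x\<in>keys B. if x = w then vpow (- 2 * int (len w)) * ?c else 0)"
      unfolding lookup_T_plus_one
    proof (rule sum.cong)
      fix x assume "x \<in> keys B"
      then have "x \<noteq> z" using Bz by (auto simp: in_keys_iff)
      moreover have "twist s x = z \<longleftrightarrow> x = w"
        unfolding z_def using twist_twist[OF simple_involution[OF s]] by metis
      ultimately show "lookup B x * (T_coeff s x *
          (lookup (basis_elt x) z + lookup (basis_elt (twist s x)) z))
          = (if x = w then vpow (- 2 * int (len w)) * ?c else 0)"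
        by (auto simp: lookup_basis_elt B(2))
    qed simp
    also have "\<dots> = vpow (- 2 * int (len w)) * ?c"
      using B(2) by (simp add: in_keys_iff vpow_def)
    finally show ?thesis .
  qed
  have "bar C = basis_elt z"
  proof -
    have V: "basis_elt w \<in> V" "basis_elt z \<in> V" using w zI by (auto simp: free_module_v_closed)
    have TV: "T_plus_one s B \<in> V" using T_plus_one_closed[OF BV s] .
    \<comment> \<open>Bar is applied twice to \<open>(T_s + 1) a_w\<close>: its commutation rule is
      used at \<open>basis_elt w\<close> and at \<open>B\<close>, and the two powers of
      \<open>u\<close> cancel.\<close>
    have "T_plus_one s (basis_elt w) = upow 2 *\<^sub>L upow (- 2) *\<^sub>L T_plus_one s (bar B)"
      by (simp add: B(1) upow_def vpow_add)
    also have "\<dots> = upow 2 *\<^sub>L bar (T_plus_one s B)"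
      using bar_T[OF bar_free_module_u[OF basis_free_module_u[OF w]] s] by (simp add: B_def)
    also have "\<dots> = bar (upow (- 2) *\<^sub>L T_plus_one s B)"
      using TV by (simp add: upow_def bar_vpow)
    also have "upow (- 2) *\<^sub>L T_plus_one s B = bar (T_plus_one s (basis_elt w))"
      using bar_T[OF basis_free_module_u[OF w] s] by (simp add: B_def)
    finally have bb: "bar (bar (?c *\<^sub>L (basis_elt w + basis_elt z))) = ?c *\<^sub>L (basis_elt w + basis_elt z)"
      by (simp add: T_plus_one_basis_elt T_plus_one_basis_eq z_def)
    have "bar (?c *\<^sub>L (basis_elt w + basis_elt z)) = lbar ?c *\<^sub>L (B + C)"
      using V by (simp add: bar_lscale bar_add free_module_v_closed B_def C_def)
    then have "bar (bar (?c *\<^sub>L (basis_elt w + basis_elt z))) = ?c *\<^sub>L (basis_elt w + bar C)"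
      using BV CV by (simp add: bar_lscale bar_add free_module_v_closed B(1))
    then have cc: "?c *\<^sub>L (basis_elt w + bar C) = ?c *\<^sub>L (basis_elt w + basis_elt z)" using bb by simp
    have "?c * (lookup (basis_elt w) y + lookup (bar C) y)
        = ?c * (lookup (basis_elt w) y + lookup (basis_elt z) y)" for y
      using arg_cong[OF cc, of "\<lambda>m. lookup m y"] by (simp add: lookup_add)
    then have "lookup (bar C) y = lookup (basis_elt z) y" for y
      unfolding T_coeff_up_cancel(1)[OF w s up] by simp
    then show ?thesis by (rule poly_mapping_eqI)
  qed
  moreover have "lookup C z = vpow (- 2 * int (len z))"
  proof -
    have "?c * lookup C z = ?c * vpow (- 2 * int (len z))"
      using eqy[of z] by (simp add: Bz Tz mult.assoc[symmetric] vpow_add mult.commute)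
    then show ?thesis unfolding T_coeff_up_cancel(1)[OF w s up] .
  qed
  moreover have "le y z" if "lookup C y \<noteq> 0" for y
  proof (rule ccontr)
    assume n: "\<not> le y z"
    then have "lookup B y = 0" using B(3) wz le_trans by blast
    moreover have "lookup (T_plus_one s B) y = 0" using Tle n by blast
    ultimately have "?c * lookup C y = ?c * 0" using eqy[of y] by simp
    then show False using that unfolding T_coeff_up_cancel(1)[OF w s up] by simp
  qed
  moreover have "- 2 * int (len z) \<le> k" if k: "lookup (lookup C y) k \<noteq> 0" for y k
  \<comment> \<open>The relation bounds the exponents of \<open>B + C\<close> only. Where
    \<open>B\<close> has no term at \<open>k\<close>, those are exponents of \<open>C\<close>;
    elsewhere the bound for \<open>B\<close> is already stronger, as \<open>w\<close> is shorter
    than \<open>z\<close>.\<close>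
  proof (cases "lookup (lookup B y) k = 0")
    case True
    then have "lookup (lookup B y + lookup C y) k \<noteq> 0" using k by (simp add: lookup_add)
    then show ?thesis
    proof (rule T_coeff_up_cancel(2)[OF w s up, rotated])
      fix j assume "lookup (?c * (lookup B y + lookup C y)) j \<noteq> 0"
      then have "lookup (lookup (T_plus_one s B) y) (j - (2 * int (len w) - 2 * int (len z))) \<noteq> 0"
        by (simp add: eqy lookup_vpow_mult)
      with B(4) have "- 2 * int (len w) \<le> j - (2 * int (len w) - 2 * int (len z))"
        by (rule T_plus_one_exponents)
      then show "- 2 * int (len z) \<le> j" by simp
    qed
  next
    case False
    then show ?thesis using B(4)[of y k] lz by simp
  qed
  ultimately show ?case unfolding C_def z_def by blast
qed

sublocale triangular_bar I bar le len
proof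
  show "finite {y \<in> I. le y w}" for w
    by (rule finite_subset[OF _ finite_len_le[of "len w"]])
      (auto dest: le_len involution_weyl)
qed (use bar_basis bar_basis_even le_len in \<open>auto intro: le_trans\<close>)

section \<open>Canonical elements of the Weyl group module\<close>

text \<open>Multiplication by \<open>v^(len w)\<close> translates between the coefficients of
  \<open>A\<close> and polynomials in \<open>u\<close>, and the half-integral degree bound becomes
  an integer inequality.\<close>

lemma is_canonical_elt_iff:
  assumes w: "w \<in> I"
  shows "is_canonical_elt W S bar w A \<longleftrightarrow> canonical w A"
proof
  let ?K = "{y \<in> I. le y w}"
  have f: "finite ?K" by (rule finite_below[OF w])
  have lk: "lookup (vpow n *\<^sub>L (\<Sum>y\<in>?K. c y *\<^sub>L basis_elt y)) x
      = (if x \<in> ?K then vpow n * c x else 0)" for n c x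
  proof -
    have "(\<Sum>y\<in>?K. c y * lookup (basis_elt y) x) = (\<Sum>y\<in>?K. if y = x then c x else 0)"
      by (rule sum.cong) (auto simp: lookup_basis_elt)
    then show ?thesis using f by (simp add: lookup_sum)
  qed
  {
    assume "is_canonical_elt W S bar w A"
    then obtain P where A: "A = vpow (- int (len w)) *\<^sub>L (\<Sum>y\<in>?K. u_poly (P y) *\<^sub>L basis_elt y)"
      and bA: "bar A = A" and Pw: "P w = 1"
      and deg: "\<And>y. y \<in> I \<Longrightarrow> bruhat_less W S y w \<Longrightarrow>
        real (Polynomial.degree (P y)) \<le> (real (len w) - real (len y) - 1) / 2"
      unfolding is_canonical_elt_def by blast
    have Ay: "lookup A y = (if y \<in> ?K then vpow (- int (len w)) * u_poly (P y) else 0)" for y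
      unfolding A by (rule lk)
    have "lookup A w = vpow (- int (len w))" using w by (simp add: Ay Pw u_poly_def)
    moreover have "A \<in> V" by (simp add: free_module_v_iff Ay)
    moreover have "k < - int (len y) \<and> - int (len w) \<le> k \<and> even (k + int (len w))"
      if "y \<noteq> w" "lookup (lookup A y) k \<noteq> 0" for y k
    proof -
      have y: "y \<in> I" "le y w" using that by (auto simp: Ay split: if_splits)
      have "lookup (u_poly (P y)) (k + int (len w)) \<noteq> 0"
        using that y by (simp add: Ay lookup_vpow_mult)
      then have k: "0 \<le> k + int (len w)" "even (k + int (len w))"
        and c: "poly.coeff (P y) (nat ((k + int (len w)) div 2)) \<noteq> 0"
        by (auto simp: lookup_u_poly split: if_splits)
      have "nat ((k + int (len w)) div 2) \<le> Polynomial.degree (P y)" by (rule le_degree[OF c])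
      then have "real (nat ((k + int (len w)) div 2)) \<le> (real (len w) - real (len y) - 1) / 2"
        using deg[OF y(1)] that y by (simp add: bruhat_less_def)
      \<comment> \<open>Doubling and moving all subtracted terms across gives an inequality of
        natural numbers. The division by 2 is exact by parity.\<close>
      then have "real (2 * nat ((k + int (len w)) div 2) + len y + 1) \<le> real (len w)"
        by (simp add: field_simps)
      then have "2 * nat ((k + int (len w)) div 2) + len y + 1 \<le> len w" by (simp only: of_nat_le_iff)
      moreover obtain j where j: "k + int (len w) = 2 * j" using k(2) by (elim evenE)
      ultimately have "2 * j + int (len y) + 1 \<le> int (len w)" using k(1) by simp
      then show ?thesis using k j by (intro conjI) linarith+
    qed
    ultimately show "canonical w A"
      using bA by (auto simp: canonical_def Ay split: if_splits)
  next
    assume "canonical w A"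
    then have A: "A \<in> V" "bar A = A" "lookup A w = vpow (- int (len w))"
      "\<And>y. lookup A y \<noteq> 0 \<Longrightarrow> le y w"
      "\<And>y k. y \<noteq> w \<Longrightarrow> lookup (lookup A y) k \<noteq> 0 \<Longrightarrow>
        k < - int (len y) \<and> - int (len w) \<le> k \<and> even (k + int (len w))"
      by (auto simp: canonical_def)
    have "\<exists>p. u_poly p = vpow (int (len w)) * lookup A y" if "y \<noteq> w" for y
    proof (rule u_poly_exists)
      fix k assume "lookup (vpow (int (len w)) * lookup A y) k \<noteq> 0"
      then show "0 \<le> k \<and> even k" using A(5)[OF that, of "k - int (len w)"] by (auto simp: lookup_vpow_mult)
    qed
    then obtain P' where P': "\<And>y. y \<noteq> w \<Longrightarrow> u_poly (P' y) = vpow (int (len w)) * lookup A y" by metis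
    \<comment> \<open>At \<open>w\<close> the exponent bounds of \<open>canonical\<close> say
      nothing, so the polynomial there is set to 1, in agreement with the leading coefficient of
      \<open>A\<close>.\<close>
    define P where "P y = (if y = w then 1 else P' y)" for y
    have P: "u_poly (P y) = vpow (int (len w)) * lookup A y" for y
      using P'[of y] by (simp add: P_def A(3) vpow_add u_poly_def)
    have "A = vpow (- int (len w)) *\<^sub>L (\<Sum>y\<in>?K. u_poly (P y) *\<^sub>L basis_elt y)"
    proof (rule poly_mapping_eqI)
      fix x
      show "lookup A x = lookup (vpow (- int (len w)) *\<^sub>L (\<Sum>y\<in>?K. u_poly (P y) *\<^sub>L basis_elt y)) x"
        unfolding lk using A(1,4) by (auto simp: P mult.assoc[symmetric] vpow_add free_module_v_iff)
    qed
    moreover have "real (Polynomial.degree (P y)) \<le> (real (len w) - real (len y) - 1) / 2"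
      if "y \<in> I" "bruhat_less W S y w" for y
    proof -
      have y: "y \<noteq> w" "len y < len w" using that le_len[of y w] by (auto simp: bruhat_less_def)
      show ?thesis
      proof (cases "P y = 0")
        \<comment> \<open>The zero polynomial has degree 0, and the bound is nonnegative because
          \<open>len y < len w\<close>.\<close>
        case True
        then show ?thesis using y by simp
      next
        case False
        have "lookup (u_poly (P y)) (2 * int (Polynomial.degree (P y))) \<noteq> 0"
          using False by (simp add: lookup_u_poly)
        then have "lookup (lookup A y) (2 * int (Polynomial.degree (P y)) - int (len w)) \<noteq> 0"
          by (simp add: P lookup_vpow_mult)
        then have "2 * int (Polynomial.degree (P y)) - int (len w) < - int (len y)"
          using A(5)[OF y(1)] by blast
        then have "2 * Polynomial.degree (P y) + len y + 1 \<le> len w" by linarith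
        then have "real (2 * Polynomial.degree (P y) + len y + 1) \<le> real (len w)"
          by (simp only: of_nat_le_iff)
        then show ?thesis by (simp add: field_simps)
      qed
    qed
    ultimately show "is_canonical_elt W S bar w A"
      unfolding is_canonical_elt_def using A(2) by (intro exI[of _ P]) (simp add: P_def)
  }
qed

theorem canonical_elements:
  "(\<forall>w\<in>I. \<exists>!A. is_canonical_elt W S bar w A) \<and>
   is_basis_family I (\<lambda>w. THE A. is_canonical_elt W S bar w A) (free_module_v I)"
proof
  show ex: "\<forall>w\<in>I. \<exists>!A. is_canonical_elt W S bar w A"
    using canonical_exists canonical_unique by (auto simp: is_canonical_elt_iff)
  then have "canonical w (THE A. is_canonical_elt W S bar w A)" if "w \<in> I" for w
    using theI'[of "is_canonical_elt W S bar w"] that by (auto simp: is_canonical_elt_iff)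
  then show "is_basis_family I (\<lambda>w. THE A. is_canonical_elt W S bar w A) (free_module_v I)"
    by (rule canonical_basis)
qed

end

theorem theorem0p3:
  fixes \<Phi> \<Delta> :: "'a::euclidean_space set"
    and W S :: "('a \<Rightarrow> 'a) set"
    and bar :: "(('a \<Rightarrow> 'a) \<Rightarrow>\<^sub>0 laurent) \<Rightarrow> (('a \<Rightarrow> 'a) \<Rightarrow>\<^sub>0 laurent)"
  assumes "root_system \<Phi>" and "root_base \<Phi> \<Delta>"
    and "W = weyl_group \<Phi>" and "S = simple_reflections \<Delta>"
    and "is_bar W S bar"
  shows "(\<forall>w\<in>involutions W. \<exists>!A. is_canonical_elt W S bar w A) \<and>
         is_basis_family (involutions W) (\<lambda>w. THE A. is_canonical_elt W S bar w A)
           (free_module_v (involutions W))"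
proof -
  interpret weyl_bar \<Phi> \<Delta> bar
    using assms by unfold_locales auto
  show ?thesis
    using canonical_elements unfolding assms(3,4) .
qed

end
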